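(* Let $n,d,T\ge1$ be integers and let $p,q\in[1,\infty]$ be Hölder conjugates. Let $f_1,\dots,f_n:\mathbb{R}^d\to\mathbb{R}$ be continuously differentiable and let $L_q>0$ be such that $\|\nabla f_i(x)-\nabla f_i(y)\|_p\le L_q\|x-y\|_q$ for all $i\in\{1,\dots,n\}$ and $x,y\in\mathbb{R}^d$. Let $f=\frac1n\sum_{i=1}^nf_i$. Then for all $D,\gamma>0$ and every starting point $x_1\in\mathbb{R}^d$: the iterates of SignSVRG, Variant 1 (see context), run with parameters $L_q,D,\gamma$, satisfy $$\frac1T\,\mathbb{E}\left[\sum_{t=1}^T\frac{\|\nabla f(x_t)\|^2}{2L_qD+\|\nabla f(x_t)\|_p}\right]\le\frac{\mathbb{E}[f(x_1)-f(x_{T+1})]}{T\gamma}+\frac{L_q\gamma d^{2/q}}{2},$$ and the iterates of SignSVRG, Variant 2 (see context), run with parameters $L_q,D,\gamma$, satisfy $$\frac1T\,\mathbb{E}\left[\sum_{t=1}^T\frac{\|\nabla f(x_t)\|_1^2}{2L_q\,d\,D+\|\nabla f(x_t)\|_1}\right]\le\frac{\mathbb{E}[f(x_1)-f(x_{T+1})]}{T\gamma}+\frac{L_q\gamma d^{2/q}}{2}.$$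
   Context: $\|\cdot\|$ is the Euclidean norm, $\|\cdot\|_r$ the $\ell_r$-norm on $\mathbb{R}^d$; $u^j$ is the $j$-th coordinate of $u$; $u\otimes v$ is the coordinate-wise product; $\mathrm{sign}$ acts coordinate-wise with $\mathrm{sign}(0)=0$; $1/\infty=0$. SignSVRG algorithm. Input: deterministic $x_1\in\mathbb{R}^d$, $L_q,D,\gamma>0$. Set $k(1)=1$, $\tilde x_1=x_1$ (initial reference point), $g_1=\nabla f(x_1)$. For $t=1,\dots,T$: 1. Sample $i_t$ uniformly on $\{1,\dots,n\}$ and $U_t$ uniformly on $[-1,1]^d$, independent of each other and of the past. 2. Define $G_t\in\mathbb{R}^d$ by, for every $j\in\{1,\dots,d\}$: Variant 1: $G_t^j=L_q\|x_t-\tilde x_{k(t)}\|_q+\|g_{k(t)}\|_p$ (the same value for all $j$); Variant 2: $G_t^j=L_q\|x_t-\tilde x_{k(t)}\|_q+|g_{k(t)}^j|$. 3. Set $x_t^+=x_t-\gamma\,\mathrm{sign}\big(\nabla f_{i_t}(x_t)-\nabla f_{i_t}(\tilde x_{k(t)})+g_{k(t)}+G_t\otimes U_t\big)$ and $x_{t+1}=x_t^+$. 4. If $\|x_t^+-\tilde x_{k(t)}\|_q\le D$, keep the reference point: $k(t+1)=k(t)$. Otherwise update it: $k(t+1)=k(t)+1$, $\tilde x_{k(t+1)}=x_t^+$, $g_{k(t+1)}=\nabla f(x_t^+)$. *)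

theory Defs
  imports "HOL-Probability.Probability"
begin

definition gradient :: "(real ^ 'd \<Rightarrow> real) \<Rightarrow> real ^ 'd \<Rightarrow> real ^ 'd" where
  "gradient f x = (THE v. GDERIV f x :> v)"

definition lp_norm :: "ennreal \<Rightarrow> real ^ 'd \<Rightarrow> real" where
  "lp_norm r u =
    (if r = \<infinity> then infnorm u
     else (\<Sum>j\<in>UNIV. \<bar>u $ j\<bar> powr enn2real r) powr (1 / enn2real r))"

text \<open>The library's \<^const>\<open>sgn\<close> on \<^typ>\<open>real ^ 'd\<close> normalises the vector, so the
  coordinate-wise sign needs its own name; \<^term>\<open>sgn (0 :: real) = 0\<close>.\<close>

definition sign_vec :: "real ^ 'd \<Rightarrow> real ^ 'd" where
  "sign_vec u = (\<chi> j. sgn (u $ j))"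

definition average :: "nat \<Rightarrow> (nat \<Rightarrow> real ^ 'd \<Rightarrow> real) \<Rightarrow> real ^ 'd \<Rightarrow> real" where
  "average n f x = (1 / real n) * (\<Sum>i = 1..n. f i x)"

text \<open>A state holds the iterate \<open>x\<^sub>t\<close> and the current reference point and stored gradient, i.e. the
  entries with index \<open>k(t)\<close>; entries with smaller index are never read again, so the counter
  itself is not stored.\<close>

record 'd signsvrg_state =
  point :: "real ^ 'd"
  ref_point :: "real ^ 'd"
  ref_grad :: "real ^ 'd"

text \<open>The two choices of \<open>G\<^sub>t\<close>, as functions of \<open>x\<^sub>t\<close>, the reference point and the stored gradient.\<close>

definition scale_variant1 ::
    "ennreal \<Rightarrow> ennreal \<Rightarrow> real \<Rightarrow> real ^ 'd \<Rightarrow> real ^ 'd \<Rightarrow> real ^ 'd \<Rightarrow> real ^ 'd" where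
  "scale_variant1 p q L x z g = (\<chi> j. L * lp_norm q (x - z) + lp_norm p g)"

definition scale_variant2 ::
    "ennreal \<Rightarrow> real \<Rightarrow> real ^ 'd \<Rightarrow> real ^ 'd \<Rightarrow> real ^ 'd \<Rightarrow> real ^ 'd" where
  "scale_variant2 q L x z g = (\<chi> j. L * lp_norm q (x - z) + \<bar>g $ j\<bar>)"

text \<open>Multiplication on \<^typ>\<open>real ^ 'd\<close> is coordinate-wise, so \<open>G x z g * u\<close> below is \<open>G\<^sub>t \<otimes> U\<^sub>t\<close>.\<close>

definition signsvrg_step ::
    "(real ^ 'd \<Rightarrow> real ^ 'd \<Rightarrow> real ^ 'd \<Rightarrow> real ^ 'd) \<Rightarrow> ennreal \<Rightarrow> real \<Rightarrow> real \<Rightarrow>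
     nat \<Rightarrow> (nat \<Rightarrow> real ^ 'd \<Rightarrow> real) \<Rightarrow> nat \<Rightarrow> real ^ 'd \<Rightarrow>
     'd signsvrg_state \<Rightarrow> 'd signsvrg_state" where
  "signsvrg_step G q D \<gamma> n f i u s =
    (let x = point s; z = ref_point s; g = ref_grad s;
         x' = x - \<gamma> *\<^sub>R sign_vec (gradient (f i) x - gradient (f i) z + g + G x z g * u)
     in if lp_norm q (x' - z) \<le> D
        then \<lparr>point = x', ref_point = z, ref_grad = g\<rparr>
        else \<lparr>point = x', ref_point = x', ref_grad = gradient (average n f) x'\<rparr>)"

text \<open>The state after the given number of completed steps, driven by samples
  \<open>i 1, i 2, \<dots>\<close> and \<open>u 1, u 2, \<dots>\<close>.\<close>

primrec signsvrg_run ::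
    "(real ^ 'd \<Rightarrow> real ^ 'd \<Rightarrow> real ^ 'd \<Rightarrow> real ^ 'd) \<Rightarrow> ennreal \<Rightarrow> real \<Rightarrow> real \<Rightarrow>
     nat \<Rightarrow> (nat \<Rightarrow> real ^ 'd \<Rightarrow> real) \<Rightarrow> real ^ 'd \<Rightarrow> (nat \<Rightarrow> nat) \<Rightarrow> (nat \<Rightarrow> real ^ 'd) \<Rightarrow>
     nat \<Rightarrow> 'd signsvrg_state" where
  "signsvrg_run G q D \<gamma> n f x\<^sub>1 i u 0 =
     \<lparr>point = x\<^sub>1, ref_point = x\<^sub>1, ref_grad = gradient (average n f) x\<^sub>1\<rparr>"
| "signsvrg_run G q D \<gamma> n f x\<^sub>1 i u (Suc t) =
     signsvrg_step G q D \<gamma> n f (i (Suc t)) (u (Suc t)) (signsvrg_run G q D \<gamma> n f x\<^sub>1 i u t)"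

text \<open>The random iterate \<open>x\<^sub>t\<close>, for \<open>t \<ge> 1\<close>: \<open>t - 1\<close> steps have been completed.\<close>

definition signsvrg_iterate ::
    "(real ^ 'd \<Rightarrow> real ^ 'd \<Rightarrow> real ^ 'd \<Rightarrow> real ^ 'd) \<Rightarrow> ennreal \<Rightarrow> real \<Rightarrow> real \<Rightarrow>
     nat \<Rightarrow> (nat \<Rightarrow> real ^ 'd \<Rightarrow> real) \<Rightarrow> real ^ 'd \<Rightarrow>
     (nat \<Rightarrow> 'a \<Rightarrow> nat) \<Rightarrow> (nat \<Rightarrow> 'a \<Rightarrow> real ^ 'd) \<Rightarrow> nat \<Rightarrow> 'a \<Rightarrow> real ^ 'd" where
  "signsvrg_iterate G q D \<gamma> n f x\<^sub>1 i U t \<omega> =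
     point (signsvrg_run G q D \<gamma> n f x\<^sub>1 (\<lambda>s. i s \<omega>) (\<lambda>s. U s \<omega>) (t - 1))"

text \<open>The pairs \<open>(i\<^sub>t, U\<^sub>t)\<close> are independent over \<open>t\<close> (independence of the past: the starting point is
  deterministic, so the past of step \<open>t\<close> is a function of the earlier pairs), and within each pair
  the two components are independent. The latter is stated for the generated \<open>\<sigma>\<close>-algebras
  because \<^const>\<open>prob_space.indep_var\<close> requires both variables to have the same type.\<close>

locale signsvrg_sampling = prob_space M
  for M :: "'a measure" and n T :: nat
    and i :: "nat \<Rightarrow> 'a \<Rightarrow> nat" and U :: "nat \<Rightarrow> 'a \<Rightarrow> real ^ 'd" +
  assumes measurable_index: "t \<in> {1..T} \<Longrightarrow> i t \<in> M \<rightarrow>\<^sub>M count_space {1..n}"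
    and measurable_noise: "t \<in> {1..T} \<Longrightarrow> U t \<in> M \<rightarrow>\<^sub>M borel"
    and distr_index: "t \<in> {1..T} \<Longrightarrow> distr M (count_space {1..n}) (i t) = uniform_count_measure {1..n}"
    and distr_noise: "t \<in> {1..T} \<Longrightarrow>
      distr M borel (U t) = uniform_measure lborel (cbox (\<chi> j. - 1) (\<chi> j. 1))"
    and indep_within: "t \<in> {1..T} \<Longrightarrow>
      indep_set (sets (vimage_algebra (space M) (i t) (count_space {1..n})))
                (sets (vimage_algebra (space M) (U t) borel))"
    and indep_across: "indep_vars (\<lambda>_. count_space {1..n} \<Otimes>\<^sub>M borel) (\<lambda>t \<omega>. (i t \<omega>, U t \<omega>)) {1..T}"

end

theory Submission imports Defs begin

text \<open>Write \<open>v\<close> for the variance-reduced estimator at \<open>x\<^sub>t\<close>. Since \<open>\<bar>v\<^sup>j\<bar> \<le> G\<^sup>j\<close>, averaging over the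
  uniform noise gives \<open>E sign (v\<^sup>j + G\<^sup>j U\<^sup>j) = v\<^sup>j / G\<^sup>j\<close>, and averaging over the index turns \<open>v\<close> into
  \<open>\<nabla>f(x\<^sub>t)\<close>. The descent inequality of \<open>f\<close> for the dual pair of norms then shows that one step
  decreases \<open>f\<close> in expectation by \<open>\<gamma> \<Sum>\<^sub>j (\<nabla>f(x\<^sub>t)\<^sup>j)\<^sup>2 / G\<^sup>j\<close> up to the error \<open>L \<gamma>\<^sup>2 d\<^bsup>2/q\<^esup> / 2\<close>, and the sum
  telescopes. As \<open>x\<^sub>t\<close> stays within \<open>D\<close> of the reference point, \<open>G\<close> is close to its value for
  \<open>g = \<nabla>f(x\<^sub>t)\<close>; this bounds the decrease from below, by Cauchy-Schwarz for the second variant.\<close>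

subsection \<open>The \<open>\<ell>\<^sub>r\<close>-norms\<close>

lemma lp_norm_top [simp]: "lp_norm top u = infnorm u"
  by (simp add: lp_norm_def)

lemma lp_norm_finite:
  "r \<noteq> \<infinity> \<Longrightarrow> lp_norm r u = (\<Sum>j\<in>UNIV. \<bar>u $ j\<bar> powr enn2real r) powr (1 / enn2real r)"
  by (simp add: lp_norm_def)

lemma lp_norm_one: "lp_norm 1 u = (\<Sum>j\<in>UNIV. \<bar>u $ j\<bar>)"
  by (simp add: lp_norm_def sum_nonneg)

lemma enn2real_ge_1: "r \<ge> 1 \<Longrightarrow> r \<noteq> \<infinity> \<Longrightarrow> enn2real r \<ge> 1"
  using enn2real_mono[of 1 r] by (simp add: top.not_eq_extremum)

lemma infnorm_cart_le: "(\<And>j. \<bar>u $ j\<bar> \<le> c) \<Longrightarrow> infnorm u \<le> c"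
  by (auto simp: infnorm_Max Basis_vec_def inner_axis)

lemma lp_norm_nonneg [simp]: "0 \<le> lp_norm r u"
  by (cases "r = \<infinity>") (simp_all add: lp_norm_finite infnorm_pos_le)

lemma lp_norm_minus: "lp_norm r (- u) = lp_norm r u"
  by (simp add: lp_norm_def infnorm_neg)

lemma lp_norm_minus_commute: "lp_norm r (u - v) = lp_norm r (v - u)"
  using lp_norm_minus[of r "u - v"] by simp

lemma lp_norm_scaleR:
  assumes "r \<ge> 1"
  shows "lp_norm r (c *\<^sub>R u) = \<bar>c\<bar> * lp_norm r u"
proof (cases "r = \<infinity>")
  case False
  then have "enn2real r \<ge> 1" by (rule enn2real_ge_1[OF assms])
  then show ?thesis
    by (simp add: lp_norm_finite[OF False] abs_mult powr_mult sum_nonneg powr_powr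
        flip: sum_distrib_left)
qed (simp add: infnorm_mul)

lemma lp_norm_0 [simp]: "r \<ge> 1 \<Longrightarrow> lp_norm r 0 = 0"
  using lp_norm_scaleR[of r 0 0] by simp

lemma component_le_lp_norm:
  assumes "r \<ge> 1"
  shows "\<bar>u $ j\<bar> \<le> lp_norm r u"
proof (cases "r = \<infinity>")
  case False
  define a where "a = enn2real r"
  have a: "a \<ge> 1" unfolding a_def by (rule enn2real_ge_1[OF assms False])
  have "\<bar>u $ j\<bar> powr a \<le> (\<Sum>j\<in>UNIV. \<bar>u $ j\<bar> powr a)"
    by (rule member_le_sum) auto
  then have "(\<bar>u $ j\<bar> powr a) powr (1 / a) \<le> (\<Sum>j\<in>UNIV. \<bar>u $ j\<bar> powr a) powr (1 / a)"
    using a by (intro powr_mono2) auto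
  then show ?thesis
    using a by (simp add: lp_norm_finite[OF False] powr_powr flip: a_def)
qed (simp add: component_le_infnorm_cart)

lemma lp_norm_eq_0_iff:
  assumes "r \<ge> 1"
  shows "lp_norm r u = 0 \<longleftrightarrow> u = 0"
proof
  assume 0: "lp_norm r u = 0"
  show "u = 0"
  proof (rule vec_eq_iff[THEN iffD2, rule_format])
    show "u $ j = 0 $ j" for j
      using component_le_lp_norm[OF assms, of u j] 0 by simp
  qed
qed (use assms in simp)

lemma lp_norm_pos: "r \<ge> 1 \<Longrightarrow> u \<noteq> 0 \<Longrightarrow> 0 < lp_norm r u"
  using lp_norm_eq_0_iff[of r u] lp_norm_nonneg[of r u] by linarith

text \<open>Each of the d powers is at most 1, so the norm is at most d^(1/r). For
  \<open>r = \<infinity>\<close> the exponent \<open>enn2real (2 / r)\<close> is 0 and the bound is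
  1. The vector of interest is a sign vector.\<close>

lemma lp_norm_le_card_powr:
  fixes u :: "real ^ 'd"
  assumes "r \<ge> 1" "\<And>j. \<bar>u $ j\<bar> \<le> 1"
  shows "(lp_norm r u)\<^sup>2 \<le> real CARD('d) powr enn2real (2 / r)"
proof (cases "r = \<infinity>")
  case True
  then have "lp_norm r u \<le> 1" using infnorm_cart_le[OF assms(2)] by simp
  then show ?thesis using True by (simp add: power_le_one infnorm_pos_le)
next
  case False
  define a where "a = enn2real r"
  have a: "a \<ge> 1" unfolding a_def by (rule enn2real_ge_1[OF assms(1) False])
  have r: "r = ennreal a" using False by (simp add: a_def top.not_eq_extremum)
  have "(\<Sum>j\<in>UNIV. \<bar>u $ j\<bar> powr a) \<le> (\<Sum>j\<in>(UNIV :: 'd set). 1)"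
    using assms(2) a by (intro sum_mono) (auto intro!: powr_le1)
  then have "lp_norm r u \<le> real CARD('d) powr (1 / a)"
    using a by (auto simp: lp_norm_finite[OF False] simp flip: a_def intro!: powr_mono2 sum_nonneg)
  then have "(lp_norm r u)\<^sup>2 \<le> (real CARD('d) powr (1 / a))\<^sup>2"
    by (intro power_mono) auto
  also have "\<dots> = real CARD('d) powr (2 / a)"
    by (simp add: power2_eq_square flip: powr_add)
  also have "2 / a = enn2real (2 / r)"
    using a divide_ennreal[of 2 a] by (simp add: r)
  finally show ?thesis .
qed

text \<open>At the threshold 1 the outer root drops out, so the convexity and Young arguments can
  work with plain sums of powers.\<close>

lemma lp_norm_le_1_iff:
  assumes "r \<ge> 1" "r \<noteq> \<infinity>"
  shows "lp_norm r u \<le> 1 \<longleftrightarrow> (\<Sum>j\<in>UNIV. \<bar>u $ j\<bar> powr enn2real r) \<le> 1"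
proof -
  define S where "S = (\<Sum>j\<in>UNIV. \<bar>u $ j\<bar> powr enn2real r)"
  have S: "S \<ge> 0" unfolding S_def by (simp add: sum_nonneg)
  have a: "enn2real r \<ge> 1" by (rule enn2real_ge_1[OF assms])
  have "S powr (1 / enn2real r) \<le> 1 \<longleftrightarrow> S \<le> 1"
    using S a powr_less_mono2[of "1 / enn2real r" 1 S] powr_mono2[of "1 / enn2real r" S 1]
    by (auto simp: not_le[symmetric])
  then show ?thesis by (simp add: lp_norm_finite[OF assms(2)] S_def)
qed

text \<open>For positive \<open>x\<close> and \<open>y\<close> this is convexity of the power. If
  one of them is 0, it reduces to c^a \<le> c for c in [0, 1].\<close>

lemma powr_convex_comb:
  fixes a s t x y :: real
  assumes "a \<ge> 1" "0 \<le> s" "0 \<le> t" "s + t = 1" "0 \<le> x" "0 \<le> y"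
  shows "(s * x + t * y) powr a \<le> s * x powr a + t * y powr a"
proof -
  have le: "c powr a \<le> c" if "0 \<le> c" "c \<le> 1" for c
    using powr_mono'[of 1 a c] that assms(1) by simp
  consider "x = 0" | "y = 0" | "x > 0" "y > 0"
    using assms by linarith
  then show ?thesis
  proof cases
    case 3
    have "s = 1 - t" using assms by simp
    with 3 show ?thesis
      using convex_onD[OF powr_convex[OF assms(1)], of t x y] assms(2,3) by simp
  qed (use assms le[of s] le[of t] in \<open>auto simp: powr_mult intro!: mult_right_mono\<close>)
qed

text \<open>The convexity of \<open>t \<mapsto> t\<^sup>r\<close> makes the unit ball convex.\<close>

lemma lp_norm_convex_comb:
  assumes "r \<ge> 1" "lp_norm r u \<le> 1" "lp_norm r v \<le> 1" "0 \<le> s" "0 \<le> t" "s + t = 1"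
  shows "lp_norm r (s *\<^sub>R u + t *\<^sub>R v) \<le> 1"
proof (cases "r = \<infinity>")
  case True
  have "infnorm (s *\<^sub>R u + t *\<^sub>R v) \<le> s * infnorm u + t * infnorm v"
    using infnorm_triangle[of "s *\<^sub>R u" "t *\<^sub>R v"] assms by (simp add: infnorm_mul)
  also have "\<dots> \<le> 1"
    using assms unfolding True infinity_ennreal_def lp_norm_top by (intro convex_bound_le) auto
  finally show ?thesis using True by simp
next
  case False
  define a where "a = enn2real r"
  have a: "a \<ge> 1" unfolding a_def by (rule enn2real_ge_1[OF assms(1) False])
  have "(\<Sum>j\<in>UNIV. \<bar>(s *\<^sub>R u + t *\<^sub>R v) $ j\<bar> powr a)
      \<le> (\<Sum>j\<in>UNIV. s * \<bar>u $ j\<bar> powr a + t * \<bar>v $ j\<bar> powr a)"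
  proof (rule sum_mono)
    fix j
    have "\<bar>(s *\<^sub>R u + t *\<^sub>R v) $ j\<bar> powr a \<le> (s * \<bar>u $ j\<bar> + t * \<bar>v $ j\<bar>) powr a"
      using assms a abs_triangle_ineq[of "s * u $ j" "t * v $ j"]
      by (intro powr_mono2) (auto simp: abs_mult)
    also have "\<dots> \<le> s * \<bar>u $ j\<bar> powr a + t * \<bar>v $ j\<bar> powr a"
      using assms a by (intro powr_convex_comb) auto
    finally show "\<bar>(s *\<^sub>R u + t *\<^sub>R v) $ j\<bar> powr a \<le> s * \<bar>u $ j\<bar> powr a + t * \<bar>v $ j\<bar> powr a" .
  qed
  also have "\<dots> = s * (\<Sum>j\<in>UNIV. \<bar>u $ j\<bar> powr a) + t * (\<Sum>j\<in>UNIV. \<bar>v $ j\<bar> powr a)"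
    by (simp add: sum.distrib sum_distrib_left)
  also have "\<dots> \<le> 1"
    using assms(2-) unfolding lp_norm_le_1_iff[OF assms(1) False] a_def
    by (intro convex_bound_le) auto
  finally show ?thesis
    unfolding lp_norm_le_1_iff[OF assms(1) False] a_def .
qed

text \<open>Minkowski's inequality from convexity of the unit ball: with weights proportional to the
  two norms, the normalised vectors combine to \<open>u + v\<close> divided by the sum of the
  norms.\<close>

lemma lp_norm_triangle:
  assumes "r \<ge> 1"
  shows "lp_norm r (u + v) \<le> lp_norm r u + lp_norm r v"
proof (cases "u = 0 \<or> v = 0")
  case False
  define a b where "a = lp_norm r u" and "b = lp_norm r v"
  have pos: "a > 0" "b > 0"
    using False lp_norm_pos assms by (auto simp: a_def b_def)
  have "lp_norm r ((a / (a + b)) *\<^sub>R ((1 / a) *\<^sub>R u) + (b / (a + b)) *\<^sub>R ((1 / b) *\<^sub>R v)) \<le> 1"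
    using pos
    by (intro lp_norm_convex_comb[OF assms])
       (simp_all add: lp_norm_scaleR[OF assms] add_divide_distrib[symmetric] flip: a_def b_def)
  also have "(a / (a + b)) *\<^sub>R ((1 / a) *\<^sub>R u) + (b / (a + b)) *\<^sub>R ((1 / b) *\<^sub>R v)
      = (1 / (a + b)) *\<^sub>R (u + v)"
    using pos by (simp add: scaleR_add_right)
  finally show ?thesis
    using pos by (simp add: lp_norm_scaleR[OF assms] divide_le_eq del: scaleR_add_right flip: a_def b_def)
qed (use assms in auto)

lemma lp_norm_sum:
  assumes "r \<ge> 1"
  shows "lp_norm r (\<Sum>k\<in>A. u k) \<le> (\<Sum>k\<in>A. lp_norm r (u k))"
proof (induction A rule: infinite_finite_induct)
  case (insert k A)
  then show ?case using lp_norm_triangle[OF assms, of "u k" "\<Sum>k\<in>A. u k"] by simp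
qed (use assms in auto)

section \<open>Hoelder's inequality\<close>

lemma holder_one_top: "u \<bullet> v \<le> lp_norm 1 u * lp_norm top v" for u v :: "real ^ 'd"
proof -
  have "u \<bullet> v \<le> (\<Sum>j\<in>UNIV. \<bar>u $ j\<bar> * infnorm v)"
    unfolding inner_vec_def
  proof (rule sum_mono)
    fix j
    have "u $ j * v $ j \<le> \<bar>u $ j\<bar> * \<bar>v $ j\<bar>" by (simp flip: abs_mult)
    also have "\<dots> \<le> \<bar>u $ j\<bar> * infnorm v"
      by (intro mult_left_mono component_le_infnorm_cart) simp
    finally show "u $ j \<bullet> v $ j \<le> \<bar>u $ j\<bar> * infnorm v" by simp
  qed
  then show ?thesis by (simp add: lp_norm_one sum_distrib_right)
qed

text \<open>The endpoint exponents are covered by \<open>holder_one_top\<close>. Otherwise both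
  vectors are normalised and Young's inequality is summed over the coordinates, giving at most 1/a +
  1/b = 1.\<close>

lemma holder:
  fixes u v :: "real ^ 'd"
  assumes pq: "p \<ge> 1" "q \<ge> 1" "1 / p + 1 / q = (1 :: ennreal)"
  shows "u \<bullet> v \<le> lp_norm p u * lp_norm q v"
proof -
  consider "p = \<infinity>" "q = 1" | "p = 1" "q = \<infinity>"
    | "p \<noteq> \<infinity>" "q \<noteq> \<infinity>"
  proof -
    \<comment> \<open>Here 1/\<infinity> = 0, so conjugacy leaves 1 for the other
      reciprocal.\<close>
    have "q = 1" if "p = \<infinity>"
      using pq(3) unfolding that by (simp add: divide_eq_1_ennreal)
    moreover have "p = 1" if "q = \<infinity>"
      using pq(3) unfolding that by (simp add: divide_eq_1_ennreal)
    ultimately show thesis using that by blast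
  qed
  then show ?thesis
  proof cases
    case 1
    then show ?thesis using holder_one_top[of v u] by (simp add: inner_commute mult.commute)
  next
    case 2
    then show ?thesis using holder_one_top[of u v] by simp
  next
    case 3
    show ?thesis
    proof (cases "u = 0 \<or> v = 0")
      case False
      define a b where "a = enn2real p" and "b = enn2real q"
      have p: "p = ennreal a" and q: "q = ennreal b"
        using 3 by (simp_all add: a_def b_def top.not_eq_extremum)
      have ab: "a \<ge> 1" "b \<ge> 1"
        unfolding a_def b_def using enn2real_ge_1 pq 3 by auto
      have "ennreal (1 / a + 1 / b) = 1"
        using pq(3) ab divide_ennreal[of 1 a] divide_ennreal[of 1 b] by (simp add: p q)
      then have sum1: "1 / a + 1 / b = 1"
        using ennreal_eq_1 by blast
      define P Q where "P = lp_norm p u" and "Q = lp_norm q v"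
      have pos: "P > 0" "Q > 0"
        using False lp_norm_pos pq(1,2) by (auto simp: P_def Q_def)
      define u' v' where "u' = (1 / P) *\<^sub>R u" and "v' = (1 / Q) *\<^sub>R v"
      have "lp_norm p u' \<le> 1" "lp_norm q v' \<le> 1"
        using pq pos by (simp_all add: lp_norm_scaleR u'_def v'_def flip: P_def Q_def)
      then have le1: "(\<Sum>j\<in>UNIV. \<bar>u' $ j\<bar> powr a) \<le> 1" "(\<Sum>j\<in>UNIV. \<bar>v' $ j\<bar> powr b) \<le> 1"
        using lp_norm_le_1_iff pq 3 by (auto simp: a_def b_def)
      \<comment> \<open>An exponent equal to 1 would force the reciprocal of the other, finite one
        to be 0.\<close>
      have ab': "a > 1" "b > 1"
        using ab sum1 by (auto simp: less_le)
      have "u' \<bullet> v' \<le> (\<Sum>j\<in>UNIV. \<bar>u' $ j\<bar> powr a / a + \<bar>v' $ j\<bar> powr b / b)"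
        unfolding inner_vec_def
        by (intro sum_mono order_trans[OF _ Youngs_inequality])
           (use ab' sum1 in \<open>auto simp: abs_mult[symmetric]\<close>)
      also have "\<dots> = (\<Sum>j\<in>UNIV. \<bar>u' $ j\<bar> powr a) / a + (\<Sum>j\<in>UNIV. \<bar>v' $ j\<bar> powr b) / b"
        by (simp add: sum.distrib sum_divide_distrib)
      also have "\<dots> \<le> 1 / a + 1 / b"
        using le1 ab by (intro add_mono divide_right_mono) auto
      finally have "u' \<bullet> v' \<le> 1" using sum1 by simp
      then show ?thesis
        using pos by (simp add: u'_def v'_def field_simps flip: P_def Q_def)
    qed auto
  qed
qed

lemma borel_measurable_lp_norm [measurable]: "lp_norm r \<in> borel_measurable borel"
proof (cases "r = \<infinity>")
  case True
  have "continuous_on UNIV (infnorm :: real ^ 'd \<Rightarrow> real)" by (intro continuous_intros)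
  then have "infnorm \<in> borel_measurable (borel :: (real ^ 'd) measure)"
    by (rule borel_measurable_continuous_onI)
  then show ?thesis using True by (simp add: lp_norm_def[abs_def])
next
  case False
  show ?thesis unfolding lp_norm_finite[OF False, abs_def] by measurable
qed

subsection \<open>Smoothness of the objective\<close>

text \<open>Testing both derivatives on \<open>v - w\<close> gives squared length 0. Uniqueness is
  what gives the definite description in \<open>gradient\<close> its value.\<close>

lemma GDERIV_unique:
  assumes "GDERIV h x :> v" "GDERIV h x :> w"
  shows "v = w"
proof -
  have "(\<lambda>y. y \<bullet> v) = (\<lambda>y. y \<bullet> w)"
    using has_derivative_unique assms by (simp add: gderiv_def)
  from fun_cong[OF this, of "v - w"] have "(v - w) \<bullet> (v - w) = 0"
    by (simp add: inner_diff_right)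
  then show ?thesis by simp
qed

lemma gradient_eqI: "GDERIV h x :> v \<Longrightarrow> gradient h x = v"
  unfolding gradient_def by (blast intro: GDERIV_unique)

text \<open>The adjoint of the derivative, applied to 1, is the vector representing it.\<close>

lemma differentiable_GDERIV_gradient:
  assumes "h differentiable at x"
  shows "GDERIV h x :> gradient h x"
proof -
  obtain h' where h': "(h has_derivative h') (at x)"
    using assms by (auto simp: differentiable_def)
  have "(\<lambda>y. y \<bullet> adjoint h' 1) = h'"
    using adjoint_works[OF has_derivative_linear[OF h'], of _ 1] by (auto simp: fun_eq_iff)
  then have "GDERIV h x :> adjoint h' 1"
    using h' by (simp add: gderiv_def)
  then show ?thesis using gradient_eqI by metis
qed

lemma GDERIV_sum:
  "(\<And>m. m \<in> A \<Longrightarrow> GDERIV (h m) x :> v m) \<Longrightarrow> GDERIV (\<lambda>x. \<Sum>m\<in>A. h m x) x :> (\<Sum>m\<in>A. v m)"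
  unfolding gderiv_def inner_sum_right by (rule has_derivative_sum)

locale lipschitz_gradients =
  fixes f :: "nat \<Rightarrow> real ^ 'd \<Rightarrow> real" and n :: nat and p q :: ennreal and L :: real
  assumes n_ge_1: "n \<ge> 1"
    and p_ge_1: "p \<ge> 1" and q_ge_1: "q \<ge> 1" and conjugate: "1 / p + 1 / q = 1"
    and differentiable: "m \<in> {1..n} \<Longrightarrow> f m differentiable at x"
    and continuous_gradient: "m \<in> {1..n} \<Longrightarrow> continuous_on UNIV (gradient (f m))"
    and L_pos: "L > 0"
    and lipschitz: "m \<in> {1..n} \<Longrightarrow>
      lp_norm p (gradient (f m) x - gradient (f m) y) \<le> L * lp_norm q (x - y)"
begin

abbreviation "F \<equiv> average n f"

lemma GDERIV_average:
  "GDERIV F x :> (1 / real n) *\<^sub>R (\<Sum>m=1..n. gradient (f m) x)"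
  unfolding average_def
  using GDERIV_mult[OF GDERIV_const GDERIV_sum[of "{1..n}" f x "\<lambda>m. gradient (f m) x"],
      of "1 / real n"] differentiable
  by (auto intro!: differentiable_GDERIV_gradient simp: scaleR_sum_right)

lemma gradient_average: "gradient F x = (1 / real n) *\<^sub>R (\<Sum>m=1..n. gradient (f m) x)"
  by (rule gradient_eqI) (rule GDERIV_average)

lemma GDERIV_F: "GDERIV F x :> gradient F x"
  using GDERIV_average by (simp only: gradient_average)

lemma continuous_on_F: "continuous_on A F"
  using GDERIV_F unfolding gderiv_def
  by (meson continuous_at_imp_continuous_on has_derivative_continuous)

lemma continuous_on_gradient_F: "continuous_on UNIV (gradient F)"
  unfolding gradient_average[abs_def]
  by (intro continuous_intros continuous_gradient)

text \<open>By the triangle inequality, averaging preserves the Lipschitz constant.\<close>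

lemma lipschitz_F: "lp_norm p (gradient F x - gradient F y) \<le> L * lp_norm q (x - y)"
proof -
  have "gradient F x - gradient F y
      = (1 / real n) *\<^sub>R (\<Sum>m=1..n. gradient (f m) x - gradient (f m) y)"
    by (simp add: gradient_average sum_subtractf scaleR_diff_right)
  then have "lp_norm p (gradient F x - gradient F y)
      = lp_norm p (\<Sum>m=1..n. gradient (f m) x - gradient (f m) y) / real n"
    by (simp add: lp_norm_scaleR[OF p_ge_1])
  also have "\<dots> \<le> (\<Sum>m=1..n. L * lp_norm q (x - y)) / real n"
    using n_ge_1
    by (intro divide_right_mono order_trans[OF lp_norm_sum[OF p_ge_1]] sum_mono lipschitz) auto
  also have "\<dots> = L * lp_norm q (x - y)"
    using n_ge_1 by simp
  finally show ?thesis .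
qed

text \<open>Along the segment from \<open>x\<close> to \<open>x + w\<close>, Hoelder and the
  Lipschitz bound control the growth of the directional derivative, with the p-norm on the gradients
  and the q-norm on \<open>w\<close>.\<close>

lemma descent: "F (x + w) \<le> F x + w \<bullet> gradient F x + L / 2 * (lp_norm q w)\<^sup>2"
proof -
  \<comment> \<open>The claim is exactly \<open>\<psi> 1 \<le> \<psi> 0\<close>. The quadratic term
    is chosen so that its derivative absorbs the bound on the gradient difference.\<close>
  define \<psi> where
    "\<psi> s = F (x + s *\<^sub>R w) - s * (w \<bullet> gradient F x) - s\<^sup>2 * (L / 2 * (lp_norm q w)\<^sup>2)" for s
  have "\<psi> 1 \<le> \<psi> 0"
  proof (rule DERIV_nonpos_imp_nonincreasing[where f = \<psi>])
    fix s :: real assume s: "0 \<le> s" "s \<le> 1"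
    have "((\<lambda>s. F (x + s *\<^sub>R w)) has_derivative (\<lambda>h. (h *\<^sub>R w) \<bullet> gradient F (x + s *\<^sub>R w))) (at s)"
      by (rule has_derivative_compose[of "\<lambda>s. x + s *\<^sub>R w", OF _ GDERIV_F[unfolded gderiv_def]])
         (auto intro!: derivative_eq_intros)
    then have "((\<lambda>s. F (x + s *\<^sub>R w)) has_real_derivative w \<bullet> gradient F (x + s *\<^sub>R w)) (at s)"
      by (simp add: has_field_derivative_def mult_commute_abs)
    then have "(\<psi> has_real_derivative w \<bullet> (gradient F (x + s *\<^sub>R w) - gradient F x)
        - s * (L * (lp_norm q w)\<^sup>2)) (at s)"
      unfolding \<psi>_def by (auto intro!: derivative_eq_intros simp: inner_diff_right)
    moreover have "w \<bullet> (gradient F (x + s *\<^sub>R w) - gradient F x) \<le> s * (L * (lp_norm q w)\<^sup>2)"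
    proof -
      have "w \<bullet> (gradient F (x + s *\<^sub>R w) - gradient F x)
          \<le> lp_norm p (gradient F (x + s *\<^sub>R w) - gradient F x) * lp_norm q w"
        unfolding inner_commute[of w] by (rule holder[OF p_ge_1 q_ge_1 conjugate])
      also have "\<dots> \<le> (L * lp_norm q (s *\<^sub>R w)) * lp_norm q w"
        using lipschitz_F[of "x + s *\<^sub>R w" x] by (intro mult_right_mono) auto
      also have "\<dots> = s * (L * (lp_norm q w)\<^sup>2)"
        using s by (simp add: lp_norm_scaleR[OF q_ge_1] power2_eq_square)
      finally show ?thesis .
    qed
    ultimately show "\<exists>y. (\<psi> has_real_derivative y) (at s) \<and> y \<le> 0" by fastforce
  qed simp
  then show ?thesis by (simp add: \<psi>_def)
qed

end

subsection \<open>The noise distribution\<close>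

abbreviation cube :: "(real ^ 'd) measure" where
  "cube \<equiv> uniform_measure lborel (cbox (\<chi> j. - 1) (\<chi> j. 1))"

text \<open>Within the cube the slab is again a box. The sides in the other coordinates contribute
  the same factor \<open>P\<close> to both volumes and cancel.\<close>

lemma measure_cube_slab:
  fixes j :: "'d :: finite" and a b :: real
  assumes "- 1 \<le> a" "a \<le> b" "b \<le> 1"
  shows "measure cube {u :: real ^ 'd. a \<le> u $ j \<and> u $ j \<le> b} = (b - a) / 2"
proof -
  let ?C = "cbox (\<chi> j. - 1) (\<chi> j. 1) :: (real ^ 'd) set"
  let ?a = "\<chi> k. if k = j then a else - 1" and ?b = "\<chi> k. if k = j then b else 1"
  define P :: real where "P = (\<Prod>k\<in>UNIV - {j}. 2)"
  have "(\<chi> k. - 1) \<in> ?C" "?a \<in> cbox ?a ?b" using assms by (auto simp: mem_box_cart)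
  then have ne: "?C \<noteq> {}" "cbox ?a ?b \<noteq> {}" by blast+
  have "measure lborel ?C = 2 * P"
    unfolding content_cbox_cart[OF ne(1)] P_def by (subst prod.remove[of _ j]) auto
  moreover have "measure lborel (cbox ?a ?b) = (b - a) * P"
    unfolding content_cbox_cart[OF ne(2)] P_def
    by (subst prod.remove[of _ j]) (auto intro!: prod.cong)
  moreover have "?C \<inter> {u. a \<le> u $ j \<and> u $ j \<le> b} = cbox ?a ?b"
    using assms by (force simp: mem_box_cart split: if_splits)
  moreover have "P > 0" by (simp add: P_def)
  moreover have "emeasure lborel ?C \<noteq> 0"
    using \<open>measure lborel ?C = 2 * P\<close> \<open>P > 0\<close> by (auto simp: measure_def)
  moreover have "emeasure lborel ?C \<noteq> \<infinity>"
    using emeasure_lborel_cbox_finite[of "\<chi> j. - 1" "\<chi> j. 1 :: real ^ 'd"] by auto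
  ultimately show ?thesis
    by (subst measure_uniform_measure) simp_all
qed

lemma prob_space_cube: "prob_space (cube :: (real ^ 'd) measure)"
proof (rule prob_space_uniform_measure)
  let ?C = "cbox (\<chi> j. - 1) (\<chi> j. 1) :: (real ^ 'd) set"
  have "(\<chi> k. - 1) \<in> ?C" by (auto simp: mem_box_cart)
  then have "measure lborel ?C > 0"
    by (subst content_cbox_cart) (auto intro!: prod_pos)
  then show "emeasure lborel ?C \<noteq> 0" by (auto simp: measure_def)
  show "emeasure lborel ?C \<noteq> \<infinity>"
    using emeasure_lborel_cbox_finite[of "\<chi> j. - 1" "\<chi> j. 1 :: real ^ 'd"] by auto
qed

text \<open>For \<open>c = 0\<close> the hypothesis forces \<open>v = 0\<close>, and both sides vanish because \<open>0 / 0 = 0\<close>.\<close>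

lemma integral_cube_sgn:
  fixes j :: "'d :: finite" and v c :: real
  assumes "\<bar>v\<bar> \<le> c"
  shows "(\<integral>u. sgn (v + c * u $ j) \<partial>(cube :: (real ^ 'd) measure)) = v / c"
proof (cases "c = 0")
  case False
  then have c: "c > 0" using assms by simp
  interpret prob_space "cube :: (real ^ 'd) measure" by (rule prob_space_cube)
  \<comment> \<open>The value of \<open>u $ j\<close> at which the sign changes; the bound on
    \<open>v\<close> puts it in [-1, 1].\<close>
  define t where "t = - v / c"
  have t: "- 1 \<le> t" "t \<le> 1" using assms c by (auto simp: t_def field_simps)
  let ?A = "{u :: real ^ 'd. t \<le> u $ j \<and> u $ j \<le> 1}"
  let ?B = "{u :: real ^ 'd. - 1 \<le> u $ j \<and> u $ j \<le> t}"
  have "AE u in cube. u \<in> cbox (\<chi> j. - 1) (\<chi> j. 1 :: real ^ 'd)"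
    by (intro AE_uniform_measureI) auto
  \<comment> \<open>At \<open>u $ j = t\<close> both indicators are 1 and their difference is 0, in
    agreement with the sign of 0.\<close>
  then have "AE u in cube. sgn (v + c * u $ j) = indicat_real ?A u - indicat_real ?B u"
  proof eventually_elim
    case (elim u)
    have "v + c * u $ j = c * (u $ j - t)" using c by (simp add: t_def field_simps)
    then have "sgn (v + c * u $ j) = sgn (u $ j - t)" using c by (simp add: sgn_mult)
    moreover have "- 1 \<le> u $ j" "u $ j \<le> 1" using elim by (auto simp: mem_box_cart)
    ultimately show ?case by (auto simp: sgn_if indicator_def)
  qed
  then have "(\<integral>u. sgn (v + c * u $ j) \<partial>cube)
      = (\<integral>u. indicat_real ?A u - indicat_real ?B u \<partial>cube)"
    by (intro integral_cong_AE) measurable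
  also have "\<dots> = measure cube ?A - measure cube ?B"
    by (subst Bochner_Integration.integral_diff) (auto simp: emeasure_eq_measure)
  also have "\<dots> = v / c"
    using t by (simp add: measure_cube_slab field_simps t_def)
  finally show ?thesis .
qed (use assms in simp)

declare One_nat_def [simp del]

lemma borel_measurable_vec_lambda [measurable (raw)]:
  fixes h :: "'a \<Rightarrow> 'd :: finite \<Rightarrow> real"
  assumes "\<And>j. (\<lambda>x. h x j) \<in> borel_measurable N"
  shows "(\<lambda>x. \<chi> j. h x j) \<in> borel_measurable N"
  unfolding borel_measurable_euclidean_space[where 'c = "real ^ 'd"]
  using assms by (auto simp: Basis_vec_def inner_axis)

lemma borel_measurable_vec_nth [measurable (raw)]:
  fixes h :: "'a \<Rightarrow> real ^ 'd"
  shows "h \<in> borel_measurable N \<Longrightarrow> (\<lambda>x. h x $ j) \<in> borel_measurable N"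
  by (rule measurable_compose[OF _ borel_measurable_nth])

lemma sets_uniform_count_measure_cube [measurable_cong]:
  "sets (uniform_count_measure A \<Otimes>\<^sub>M cube) = sets (count_space A \<Otimes>\<^sub>M borel)"
  by (rule sets_pair_measure_cong) (simp_all add: sets_uniform_count_measure)

text \<open>Independence within the pair gives the product formula on rectangles, and these
  determine the joint law because both factors are sigma-finite.\<close>

lemma (in signsvrg_sampling) distr_pair:
  assumes t: "t \<in> {1..T}"
  shows "distr M (count_space {1..n} \<Otimes>\<^sub>M borel) (\<lambda>\<omega>. (i t \<omega>, U t \<omega>))
    = uniform_count_measure {1..n} \<Otimes>\<^sub>M cube"
proof (rule pair_measure_eqI[symmetric])
  note [measurable] = measurable_index[OF t] measurable_noise[OF t]
  \<comment> \<open>That the uniform measure on the indices has mass 1 is read off from its being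
    the law of \<open>i t\<close>.\<close>
  have "prob_space (distr M (count_space {1..n}) (i t))"
    by (rule prob_space_distr) measurable
  then interpret I: prob_space "uniform_count_measure {1..n}"
    unfolding distr_index[OF t] .
  interpret C: prob_space "cube :: (real ^ 'd) measure" by (rule prob_space_cube)
  show "sigma_finite_measure (uniform_count_measure {1..n})" ..
  show "sigma_finite_measure (cube :: (real ^ 'd) measure)" ..
  show "sets (uniform_count_measure {1..n} \<Otimes>\<^sub>M cube)
      = sets (distr M (count_space {1..n} \<Otimes>\<^sub>M borel) (\<lambda>\<omega>. (i t \<omega>, U t \<omega>)))"
    by (simp only: sets_uniform_count_measure_cube sets_distr)
  fix A B assume "A \<in> sets (uniform_count_measure {1..n})" and "B \<in> sets (cube :: (real ^ 'd) measure)"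
  then have AB [measurable]: "A \<in> sets (count_space {1..n})" "B \<in> sets borel"
    by (simp_all add: sets_uniform_count_measure)
  have "emeasure (distr M (count_space {1..n} \<Otimes>\<^sub>M borel) (\<lambda>\<omega>. (i t \<omega>, U t \<omega>))) (A \<times> B)
      = emeasure M ((i t -` A \<inter> space M) \<inter> (U t -` B \<inter> space M))"
    by (subst emeasure_distr) (auto intro!: arg_cong[where f = "emeasure M"])
  also have "\<dots> = emeasure M (i t -` A \<inter> space M) * emeasure M (U t -` B \<inter> space M)"
    unfolding emeasure_eq_measure
    using indep_setD[OF indep_within[OF t] in_vimage_algebra[OF AB(1)] in_vimage_algebra[OF AB(2)]]
    by (simp add: ennreal_mult)
  also have "\<dots> = emeasure (distr M (count_space {1..n}) (i t)) A * emeasure (distr M borel (U t)) B"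
    by (simp only: emeasure_distr[OF measurable_index[OF t] AB(1)]
        emeasure_distr[OF measurable_noise[OF t] AB(2)])
  finally show "emeasure (uniform_count_measure {1..n}) A * emeasure cube B
      = emeasure (distr M (count_space {1..n} \<Otimes>\<^sub>M borel) (\<lambda>\<omega>. (i t \<omega>, U t \<omega>))) (A \<times> B)"
    by (simp add: distr_index[OF t] distr_noise[OF t])
qed

subsection \<open>One step in expectation\<close>

lemma (in lipschitz_gradients) borel_measurable_gradient [measurable]:
  "m \<in> {1..n} \<Longrightarrow> gradient (f m) \<in> borel_measurable borel"
  by (intro borel_measurable_continuous_onI continuous_gradient)

lemma (in lipschitz_gradients) borel_measurable_gradient_F [measurable]: "gradient F \<in> borel_measurable borel"
  by (intro borel_measurable_continuous_onI continuous_on_gradient_F)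

text \<open>The scale \<open>G\<close> stays abstract so that both variants share one analysis. It
  is only evaluated at the stored gradient \<open>gradient F z\<close>. Domination is what makes the
  noise average linear in the estimator.\<close>

locale signsvrg = lipschitz_gradients f n p q L + signsvrg_sampling M n T i U
  for f :: "nat \<Rightarrow> real ^ 'd \<Rightarrow> real" and n p q L
    and M :: "'a measure" and T i and U :: "nat \<Rightarrow> 'a \<Rightarrow> real ^ 'd" +
  fixes G :: "real ^ 'd \<Rightarrow> real ^ 'd \<Rightarrow> real ^ 'd \<Rightarrow> real ^ 'd" and D \<gamma> :: real and x\<^sub>1 :: "real ^ 'd"
  assumes D_pos: "D > 0" and \<gamma>_pos: "\<gamma> > 0" and T_ge_1: "T \<ge> 1"
    and measurable_scale [measurable]:
      "(\<lambda>(x, z). G x z (gradient F z)) \<in> borel_measurable (borel \<Otimes>\<^sub>M borel)"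
    and scale_dominates: "m \<in> {1..n} \<Longrightarrow>
      \<bar>(gradient (f m) x - gradient (f m) z + gradient F z) $ j\<bar> \<le> G x z (gradient F z) $ j"
begin

section \<open>The algorithm as a chain driven by the samples\<close>

abbreviation run :: "(nat \<Rightarrow> nat \<times> (real ^ 'd)) \<Rightarrow> nat \<Rightarrow> 'd signsvrg_state" where
  "run \<xi> \<equiv> signsvrg_run G q D \<gamma> n f x\<^sub>1 (\<lambda>s. fst (\<xi> s)) (\<lambda>s. snd (\<xi> s))"

definition direction :: "(real ^ 'd) \<times> (real ^ 'd) \<Rightarrow> nat \<times> (real ^ 'd) \<Rightarrow> real ^ 'd" where
  "direction s y = (case (s, y) of ((x, z), (m, u)) \<Rightarrow> \<chi> j.
     sgn ((gradient (f m) x - gradient (f m) z + gradient F z) $ j + G x z (gradient F z) $ j * u $ j))"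

text \<open>The transition map on pairs (iterate, reference point). By \<open>ref_grad_run\<close>
  the stored gradient is determined by the reference point, so the pair is the full state.\<close>

definition next_pair :: "(real ^ 'd) \<times> (real ^ 'd) \<Rightarrow> nat \<times> (real ^ 'd) \<Rightarrow> (real ^ 'd) \<times> (real ^ 'd)" where
  "next_pair s y = (let x' = fst s - \<gamma> *\<^sub>R direction s y
     in (x', if lp_norm q (x' - snd s) \<le> D then snd s else x'))"

definition pair_of_run :: "(nat \<Rightarrow> nat \<times> (real ^ 'd)) \<Rightarrow> nat \<Rightarrow> (real ^ 'd) \<times> (real ^ 'd)" where
  "pair_of_run \<xi> t = (point (run \<xi> t), ref_point (run \<xi> t))"

lemma ref_grad_run: "ref_grad (run \<xi> t) = gradient F (ref_point (run \<xi> t))"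
  by (induction t) (simp_all add: signsvrg_step_def Let_def)

lemma pair_of_run_0: "pair_of_run \<xi> 0 = (x\<^sub>1, x\<^sub>1)"
  by (simp add: pair_of_run_def)

lemma pair_of_run_Suc: "pair_of_run \<xi> (Suc t) = next_pair (pair_of_run \<xi> t) (\<xi> (Suc t))"
  by (simp add: pair_of_run_def next_pair_def direction_def signsvrg_step_def sign_vec_def
      ref_grad_run Let_def split: prod.split)

text \<open>The state looks only at past samples; its independence of the next sample rests on
  this.\<close>

lemma pair_of_run_cong:
  "(\<And>s. s \<in> {1..t} \<Longrightarrow> \<xi> s = \<xi>' s) \<Longrightarrow> pair_of_run \<xi> t = pair_of_run \<xi>' t"
  by (induction t) (simp_all add: pair_of_run_0 pair_of_run_Suc)

text \<open>For a frozen index the map is built from measurable gradients and scales; the index has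
  only finitely many values.\<close>

lemma measurable_direction [measurable]:
  "(\<lambda>(s, y). direction s y)
    \<in> (borel \<Otimes>\<^sub>M borel) \<Otimes>\<^sub>M (count_space {1..n} \<Otimes>\<^sub>M borel) \<rightarrow>\<^sub>M borel"
proof -
  have [measurable]: "(\<lambda>w. G (fst (fst w)) (snd (fst w)) (gradient F (snd (fst w))))
      \<in> (borel \<Otimes>\<^sub>M borel) \<Otimes>\<^sub>M (count_space {1..n} \<Otimes>\<^sub>M borel) \<rightarrow>\<^sub>M borel"
    using measurable_compose[OF measurable_fst measurable_scale] by (simp add: case_prod_unfold)
  have "(\<lambda>w. \<chi> j. sgn ((gradient (f m) (fst (fst w)) - gradient (f m) (snd (fst w))
          + gradient F (snd (fst w))) $ j
        + G (fst (fst w)) (snd (fst w)) (gradient F (snd (fst w))) $ j * snd (snd w) $ j))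
      \<in> (borel \<Otimes>\<^sub>M borel) \<Otimes>\<^sub>M (count_space {1..n} \<Otimes>\<^sub>M borel) \<rightarrow>\<^sub>M borel"
    if "m \<in> {1..n}" for m
  proof -
    note [measurable] = borel_measurable_gradient[OF that]
    show ?thesis by measurable
  qed
  from measurable_compose_countable'[OF this, where I = "{1..n}" and g = "\<lambda>w. fst (snd w)"]
  show ?thesis
    unfolding direction_def by (simp add: case_prod_unfold)
qed

lemma measurable_next_pair [measurable]:
  "(\<lambda>(s, y). next_pair s y)
    \<in> (borel \<Otimes>\<^sub>M borel) \<Otimes>\<^sub>M (count_space {1..n} \<Otimes>\<^sub>M borel) \<rightarrow>\<^sub>M borel \<Otimes>\<^sub>M borel"
proof -
  have [measurable]: "(\<lambda>w. direction (fst w) (snd w))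
      \<in> (borel \<Otimes>\<^sub>M borel) \<Otimes>\<^sub>M (count_space {1..n} \<Otimes>\<^sub>M borel) \<rightarrow>\<^sub>M borel"
    using measurable_direction by (simp add: case_prod_unfold)
  show ?thesis
    unfolding next_pair_def Let_def case_prod_unfold by measurable
qed

text \<open>The index set \<open>A\<close> may exceed \<open>{1..t}\<close>, so that one and the
  same product space serves throughout the induction.\<close>

lemma measurable_pair_of_run:
  "{1..t} \<subseteq> A \<Longrightarrow>
    (\<lambda>\<xi>. pair_of_run \<xi> t) \<in> (\<Pi>\<^sub>M s\<in>A. count_space {1..n} \<Otimes>\<^sub>M borel) \<rightarrow>\<^sub>M borel \<Otimes>\<^sub>M borel"
proof (induction t)
  case (Suc t)
  have "{1..t} \<subseteq> A" using Suc.prems by auto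
  then have "(\<lambda>\<xi>. pair_of_run \<xi> t) \<in> (\<Pi>\<^sub>M s\<in>A. count_space {1..n} \<Otimes>\<^sub>M borel) \<rightarrow>\<^sub>M borel \<Otimes>\<^sub>M borel"
    by (rule Suc.IH)
  moreover have "(\<lambda>\<xi>. \<xi> (Suc t)) \<in> (\<Pi>\<^sub>M s\<in>A. count_space {1..n} \<Otimes>\<^sub>M borel)
      \<rightarrow>\<^sub>M count_space {1..n} \<Otimes>\<^sub>M (borel :: (real ^ 'd) measure)"
    using Suc.prems by (intro measurable_component_singleton) auto
  ultimately show ?case
    unfolding pair_of_run_Suc
    using measurable_compose[OF measurable_Pair measurable_next_pair] by simp
qed (simp add: pair_of_run_0)

section \<open>The process on the probability space\<close>

definition sample :: "'a \<Rightarrow> nat \<Rightarrow> nat \<times> (real ^ 'd)" where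
  "sample \<omega> s = (i s \<omega>, U s \<omega>)"

text \<open>Indexed by completed steps: \<open>X t\<close> is the iterate with index t + 1 in the
  statement.\<close>

definition X :: "nat \<Rightarrow> 'a \<Rightarrow> real ^ 'd" where
  "X t \<omega> = fst (pair_of_run (sample \<omega>) t)"

definition Z :: "nat \<Rightarrow> 'a \<Rightarrow> real ^ 'd" where
  "Z t \<omega> = snd (pair_of_run (sample \<omega>) t)"

lemma signsvrg_iterate_eq: "signsvrg_iterate G q D \<gamma> n f x\<^sub>1 i U t \<omega> = X (t - 1) \<omega>"
  by (simp add: signsvrg_iterate_def X_def pair_of_run_def sample_def)

lemma X_0: "X 0 \<omega> = x\<^sub>1"
  by (simp add: X_def pair_of_run_0)

lemma X_Suc: "X (Suc t) \<omega> = X t \<omega> - \<gamma> *\<^sub>R direction (X t \<omega>, Z t \<omega>) (sample \<omega> (Suc t))"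
  by (simp add: X_def Z_def pair_of_run_Suc next_pair_def Let_def)

lemma abs_direction_le_1: "\<bar>direction s y $ j\<bar> \<le> 1"
  by (auto simp: direction_def sgn_if split: prod.split)

text \<open>A step moves each coordinate by at most \<gamma>. The iterate is thus confined to a
  deterministic box, the source of all integrability.\<close>

lemma X_near_start: "\<bar>X t \<omega> $ j - x\<^sub>1 $ j\<bar> \<le> real t * \<gamma>"
proof (induction t)
  case (Suc t)
  have "\<bar>\<gamma> * direction (X t \<omega>, Z t \<omega>) (sample \<omega> (Suc t)) $ j\<bar> \<le> \<gamma>"
    using abs_direction_le_1 \<gamma>_pos by (simp add: abs_mult)
  then show ?case using Suc by (simp add: X_Suc algebra_simps)
qed (simp add: X_0)

text \<open>Either the reference point passed the test of the algorithm, or it was just reset to the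
  iterate and the distance is 0.\<close>

lemma distance_to_reference: "lp_norm q (X t \<omega> - Z t \<omega>) \<le> D"
proof (cases t)
  case 0
  then show ?thesis using D_pos q_ge_1 by (simp add: X_def Z_def pair_of_run_0)
next
  case (Suc t')
  then show ?thesis
    using D_pos q_ge_1 by (simp add: X_def Z_def pair_of_run_Suc next_pair_def Let_def)
qed

lemma measurable_sample:
  "t \<in> {1..T} \<Longrightarrow> (\<lambda>\<omega>. sample \<omega> t) \<in> M \<rightarrow>\<^sub>M count_space {1..n} \<Otimes>\<^sub>M borel"
  unfolding sample_def by (intro measurable_Pair measurable_index measurable_noise)

lemma pair_eq_restrict:
  "(X t \<omega>, Z t \<omega>) = pair_of_run (restrict (sample \<omega>) {1..t}) t"
  unfolding X_def Z_def prod.collapse by (rule pair_of_run_cong) simp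

lemma measurable_pair_X_Z:
  assumes "t \<le> T"
  shows "(\<lambda>\<omega>. (X t \<omega>, Z t \<omega>)) \<in> M \<rightarrow>\<^sub>M borel \<Otimes>\<^sub>M borel"
  unfolding pair_eq_restrict
  using assms
  by (intro measurable_compose[OF measurable_restrict measurable_pair_of_run[OF order_refl]]
      measurable_sample) auto

lemma measurable_X: "t \<le> T \<Longrightarrow> X t \<in> M \<rightarrow>\<^sub>M borel"
  using measurable_compose[OF measurable_pair_X_Z measurable_fst] by simp

text \<open>The state is a function of the samples up to \<open>t\<close> and \<open>Y\<close> is
  the next one. Disjoint blocks of an independent family are independent, and so are functions of
  them.\<close>

lemma joint_distr_pair_sample:
  fixes t defines "S \<equiv> \<lambda>\<omega>. (X t \<omega>, Z t \<omega>)" and "Y \<equiv> \<lambda>\<omega>. sample \<omega> (Suc t)"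
  assumes "t < T"
  shows "distr M (borel \<Otimes>\<^sub>M borel) S \<Otimes>\<^sub>M distr M (count_space {1..n} \<Otimes>\<^sub>M borel) Y
    = distr M ((borel \<Otimes>\<^sub>M borel) \<Otimes>\<^sub>M (count_space {1..n} \<Otimes>\<^sub>M borel)) (\<lambda>\<omega>. (S \<omega>, Y \<omega>))"
proof -
  let ?B = "(borel :: (real ^ 'd) measure) \<Otimes>\<^sub>M (borel :: (real ^ 'd) measure)"
  let ?N = "count_space {1..n} \<Otimes>\<^sub>M (borel :: (real ^ 'd) measure)"
  let ?P = "\<lambda>A. \<Pi>\<^sub>M s\<in>A. ?N" and ?V = "\<lambda>A \<omega>. restrict (\<lambda>s. sample \<omega> s) A"
  define \<phi> where "\<phi> \<xi> = pair_of_run \<xi> t" for \<xi>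
  define \<psi> where "\<psi> \<xi> = \<xi> (Suc t)" for \<xi> :: "nat \<Rightarrow> nat \<times> (real ^ 'd)"
  have indep: "indep_var (?P {1..t}) (?V {1..t}) (?P {Suc t}) (?V {Suc t})"
    using assms(3) unfolding sample_def by (intro indep_var_restrict[OF indep_across]) auto
  then have V [measurable]: "?V {1..t} \<in> M \<rightarrow>\<^sub>M ?P {1..t}" "?V {Suc t} \<in> M \<rightarrow>\<^sub>M ?P {Suc t}"
    and joint: "distr M (?P {1..t}) (?V {1..t}) \<Otimes>\<^sub>M distr M (?P {Suc t}) (?V {Suc t})
      = distr M (?P {1..t} \<Otimes>\<^sub>M ?P {Suc t}) (\<lambda>\<omega>. (?V {1..t} \<omega>, ?V {Suc t} \<omega>))"
    unfolding indep_var_distribution_eq by blast+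
  have [measurable]: "\<phi> \<in> ?P {1..t} \<rightarrow>\<^sub>M ?B" "\<psi> \<in> ?P {Suc t} \<rightarrow>\<^sub>M ?N"
    unfolding \<phi>_def \<psi>_def by (auto intro!: measurable_pair_of_run measurable_component_singleton)
  have S: "S = \<phi> \<circ> ?V {1..t}" and Y: "Y = \<psi> \<circ> ?V {Suc t}"
    by (simp_all add: fun_eq_iff S_def Y_def \<phi>_def \<psi>_def pair_eq_restrict)
  \<comment> \<open>Sigma-finiteness of the second image law allows the product of the image laws to
    be written as an image of the product.\<close>
  have "prob_space (distr (distr M (?P {Suc t}) (?V {Suc t})) ?N \<psi>)"
    by (intro prob_space.prob_space_distr prob_space_distr) measurable
  then have "sigma_finite_measure (distr (distr M (?P {Suc t}) (?V {Suc t})) ?N \<psi>)"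
    using prob_space_imp_sigma_finite by blast
  then have "distr M ?B S \<Otimes>\<^sub>M distr M ?N Y
      = distr (distr M (?P {1..t} \<Otimes>\<^sub>M ?P {Suc t}) (\<lambda>\<omega>. (?V {1..t} \<omega>, ?V {Suc t} \<omega>)))
          (?B \<Otimes>\<^sub>M ?N) (\<lambda>(\<xi>, \<xi>'). (\<phi> \<xi>, \<psi> \<xi>'))"
    unfolding S Y joint[symmetric]
    by (subst pair_measure_distr[symmetric]) (simp_all add: distr_distr)
  also have "\<dots> = distr M (?B \<Otimes>\<^sub>M ?N) (\<lambda>\<omega>. (S \<omega>, Y \<omega>))"
    by (subst distr_distr) (simp_all add: S Y comp_def)
  finally show ?thesis .
qed

section \<open>Integrability and the mean of the sign direction\<close>

lemma integrable_continuous_X: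
  assumes "t \<le> T" "continuous_on UNIV (h :: real ^ 'd \<Rightarrow> real)"
  shows "integrable M (\<lambda>\<omega>. h (X t \<omega>))"
proof -
  \<comment> \<open>The compact box that contains \<open>X t \<omega>\<close> for every
    \<open>\<omega>\<close>, so that \<open>h\<close> is bounded there.\<close>
  let ?K = "cbox (\<chi> j. x\<^sub>1 $ j - real t * \<gamma>) (\<chi> j. x\<^sub>1 $ j + real t * \<gamma>)"
  have "bounded (h ` ?K)"
    by (intro compact_imp_bounded compact_continuous_image continuous_on_subset[OF assms(2)]) auto
  then obtain B where B: "\<And>x. x \<in> ?K \<Longrightarrow> norm (h x) \<le> B"
    by (auto simp: bounded_iff)
  have "X t \<omega> \<in> ?K" for \<omega>
    unfolding mem_box_cart using X_near_start[of t \<omega>] by (auto simp: abs_le_iff algebra_simps)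
  then show ?thesis
    using B measurable_X[OF assms(1)] borel_measurable_continuous_onI[OF assms(2)]
    by (intro integrable_const_bound[of _ B]) (auto intro: measurable_compose)
qed

text \<open>Unbiasedness of the estimator: the gradients at \<open>z\<close> average to
  \<open>gradient F z\<close> and cancel the correction.\<close>

lemma gradient_F_average:
  "gradient F x = (1 / real n) *\<^sub>R (\<Sum>m=1..n. gradient (f m) x - gradient (f m) z + gradient F z)"
  using n_ge_1
  by (simp add: sum.distrib sum_subtractf scaleR_add_right scaleR_diff_right
      sum_constant_scaleR del: sum_constant flip: gradient_average)

text \<open>Domination survives averaging over the index. In particular a vanishing scale forces a
  vanishing gradient coordinate.\<close>

lemma abs_gradient_F_le_scale: "\<bar>gradient F x $ j\<bar> \<le> G x z (gradient F z) $ j"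
proof -
  have "\<bar>gradient F x $ j\<bar>
      = \<bar>\<Sum>m=1..n. (gradient (f m) x - gradient (f m) z + gradient F z) $ j\<bar> / real n"
    by (subst gradient_F_average[of x z]) (simp add: abs_mult)
  also have "\<dots> \<le> (\<Sum>m=1..n. G x z (gradient F z) $ j) / real n"
    by (intro divide_right_mono order_trans[OF sum_abs] sum_mono scale_dominates) auto
  also have "\<dots> = G x z (gradient F z) $ j"
    using n_ge_1 by simp
  finally show ?thesis .
qed

lemma abs_inner_direction_le: "\<bar>a \<bullet> direction s y\<bar> \<le> (\<Sum>j\<in>UNIV. \<bar>a $ j\<bar>)"
  unfolding inner_vec_def
proof (rule order_trans[OF sum_abs], rule sum_mono)
  fix j
  show "\<bar>a $ j \<bullet> direction s y $ j\<bar> \<le> \<bar>a $ j\<bar>"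
    using mult_left_mono[OF abs_direction_le_1[of s y j], of "\<bar>a $ j\<bar>"] by (simp add: abs_mult)
qed

text \<open>Averaging over \<open>U\<close> replaces \<open>sgn (v + c * u)\<close> by \<open>v / c\<close>, which is linear in \<open>v\<close>, so that
  averaging over the index then produces the full gradient.\<close>

lemma integral_inner_direction:
  "(\<integral>y. gradient F x \<bullet> direction (x, z) y \<partial>(uniform_count_measure {1..n} \<Otimes>\<^sub>M cube))
    = (\<Sum>j\<in>UNIV. (gradient F x $ j)\<^sup>2 / G x z (gradient F z) $ j)"
proof -
  let ?I = "uniform_count_measure {1..n}" and ?C = "cube :: (real ^ 'd) measure"
  define v where "v m = gradient (f m) x - gradient (f m) z + gradient F z" for m
  define c where "c = G x z (gradient F z)"
  define a where "a = gradient F x"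
  interpret I: prob_space ?I
    using n_ge_1 by (intro prob_space_uniform_count_measure) auto
  interpret C: prob_space ?C by (rule prob_space_cube)
  interpret pair_prob_space ?I ?C ..
  have [measurable]: "(\<lambda>y. direction (x, z) y) \<in> borel_measurable (count_space {1..n} \<Otimes>\<^sub>M borel)"
    using measurable_compose[OF measurable_Pair1' measurable_direction, of "(x, z)"]
    by (simp add: space_pair_measure)
  have meas: "(\<lambda>y. a \<bullet> direction (x, z) y) \<in> borel_measurable (?I \<Otimes>\<^sub>M ?C)"
    by measurable
  have int: "integrable (?I \<Otimes>\<^sub>M ?C) (\<lambda>y. a \<bullet> direction (x, z) y)"
    using abs_inner_direction_le meas
    by (intro integrable_const_bound[of _ "\<Sum>j\<in>UNIV. \<bar>a $ j\<bar>"]) auto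
  have inner: "(\<integral>u. a \<bullet> direction (x, z) (m, u) \<partial>?C) = (\<Sum>j\<in>UNIV. a $ j * (v m $ j / c $ j))"
    if m: "m \<in> {1..n}" for m
  proof -
    have "(\<integral>u. a \<bullet> direction (x, z) (m, u) \<partial>?C)
        = (\<integral>u. (\<Sum>j\<in>UNIV. a $ j * sgn (v m $ j + c $ j * u $ j)) \<partial>?C)"
      by (simp add: inner_vec_def direction_def v_def c_def)
    also have "\<dots> = (\<Sum>j\<in>UNIV. a $ j * (\<integral>u. sgn (v m $ j + c $ j * u $ j) \<partial>?C))"
    proof (subst Bochner_Integration.integral_sum)
      fix j
      have "integrable ?C (\<lambda>u. sgn (v m $ j + c $ j * u $ j))"
        by (rule C.integrable_const_bound[of _ 1]) (auto simp: sgn_if)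
      then show "integrable ?C (\<lambda>u. a $ j * sgn (v m $ j + c $ j * u $ j))" by simp
    qed simp
    also have "\<dots> = (\<Sum>j\<in>UNIV. a $ j * (v m $ j / c $ j))"
      using scale_dominates[OF m, of x z] by (simp only: integral_cube_sgn v_def c_def)
    finally show ?thesis .
  qed
  have "(\<integral>y. a \<bullet> direction (x, z) y \<partial>(?I \<Otimes>\<^sub>M ?C))
      = (\<integral>m. (\<integral>u. a \<bullet> direction (x, z) (m, u) \<partial>?C) \<partial>?I)"
    by (rule integral_fst'[OF int, symmetric])
  also have "\<dots> = (\<Sum>m=1..n. \<Sum>j\<in>UNIV. a $ j * (v m $ j / c $ j)) / real n"
    by (simp add: integral_uniform_count_measure inner)
  also have "\<dots> = (\<Sum>j\<in>UNIV. a $ j * ((1 / real n * (\<Sum>m=1..n. v m $ j)) / c $ j))"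
    by (subst sum.swap) (simp add: sum_divide_distrib sum_distrib_left mult_ac)
  also have "\<dots> = (\<Sum>j\<in>UNIV. (a $ j)\<^sup>2 / c $ j)"
  proof (intro sum.cong refl)
    fix j
    have "a $ j = 1 / real n * (\<Sum>m=1..n. v m $ j)"
      unfolding a_def v_def by (subst gradient_F_average[of x z]) simp
    then show "a $ j * ((1 / real n * (\<Sum>m=1..n. v m $ j)) / c $ j) = (a $ j)\<^sup>2 / c $ j"
      by (simp add: power2_eq_square)
  qed
  finally show ?thesis by (simp add: a_def c_def)
qed

lemma integrable_inner_direction:
  assumes "t < T"
  shows "integrable M (\<lambda>\<omega>. gradient F (X t \<omega>) \<bullet> direction (X t \<omega>, Z t \<omega>) (sample \<omega> (Suc t)))"
proof (rule Bochner_Integration.integrable_bound)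
  show "integrable M (\<lambda>\<omega>. \<Sum>j\<in>UNIV. \<bar>gradient F (X t \<omega>) $ j\<bar>)"
    using assms
    by (intro integrable_continuous_X) (auto intro!: continuous_intros continuous_on_gradient_F)
  have "(\<lambda>\<omega>. direction (X t \<omega>, Z t \<omega>) (sample \<omega> (Suc t))) \<in> borel_measurable M"
    using measurable_compose[OF measurable_Pair[OF measurable_pair_X_Z measurable_sample]
        measurable_direction, of t "Suc t"] assms by simp
  then show "(\<lambda>\<omega>. gradient F (X t \<omega>) \<bullet> direction (X t \<omega>, Z t \<omega>) (sample \<omega> (Suc t)))
      \<in> borel_measurable M"
    using measurable_compose[OF measurable_X borel_measurable_gradient_F, of t] assms
    by (intro borel_measurable_inner) auto
qed (use abs_inner_direction_le in \<open>auto intro: order_trans simp: sum_nonneg\<close>)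

text \<open>Fubini on the joint law takes the place of conditioning on the past: with the state
  fixed, the sample is integrated out by \<open>integral_inner_direction\<close>.\<close>

lemma expectation_inner_direction:
  assumes t: "t < T"
  shows "(\<integral>\<omega>. gradient F (X t \<omega>) \<bullet> direction (X t \<omega>, Z t \<omega>) (sample \<omega> (Suc t)) \<partial>M)
      = (\<integral>\<omega>. (\<Sum>j\<in>UNIV. (gradient F (X t \<omega>) $ j)\<^sup>2
          / G (X t \<omega>) (Z t \<omega>) (gradient F (Z t \<omega>)) $ j) \<partial>M)"
    and "integrable M (\<lambda>\<omega>. \<Sum>j\<in>UNIV. (gradient F (X t \<omega>) $ j)\<^sup>2
          / G (X t \<omega>) (Z t \<omega>) (gradient F (Z t \<omega>)) $ j)"
proof -
  let ?B = "(borel :: (real ^ 'd) measure) \<Otimes>\<^sub>M (borel :: (real ^ 'd) measure)"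
  let ?N = "count_space {1..n} \<Otimes>\<^sub>M (borel :: (real ^ 'd) measure)"
  let ?S = "\<lambda>\<omega>. (X t \<omega>, Z t \<omega>)" and ?Y = "\<lambda>\<omega>. sample \<omega> (Suc t)"
  let ?W = "uniform_count_measure {1..n} \<Otimes>\<^sub>M (cube :: (real ^ 'd) measure)"
  define h where "h w = gradient F (fst (fst w)) \<bullet> direction (fst w) (snd w)" for w
  have T: "t \<le> T" "Suc t \<in> {1..T}" using t by auto
  note [measurable] = measurable_pair_X_Z[OF T(1)] measurable_sample[OF T(2)]
  have joint: "distr M ?B ?S \<Otimes>\<^sub>M ?W = distr M (?B \<Otimes>\<^sub>M ?N) (\<lambda>\<omega>. (?S \<omega>, ?Y \<omega>))"
    using joint_distr_pair_sample[OF t] distr_pair[OF T(2)] by (simp add: sample_def)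
  have [measurable]: "(\<lambda>w. direction (fst w) (snd w)) \<in> ?B \<Otimes>\<^sub>M ?N \<rightarrow>\<^sub>M borel"
    using measurable_direction by (simp add: case_prod_unfold)
  have h: "h \<in> borel_measurable (?B \<Otimes>\<^sub>M ?N)"
    unfolding h_def by measurable
  interpret S: prob_space "distr M ?B ?S" by (rule prob_space_distr) measurable
  have "prob_space (distr M ?N ?Y)" by (rule prob_space_distr) measurable
  then interpret W: prob_space ?W
    using distr_pair[OF T(2)] by (simp add: sample_def)
  interpret pair_prob_space "distr M ?B ?S" ?W ..
  have "integrable (distr M (?B \<Otimes>\<^sub>M ?N) (\<lambda>\<omega>. (?S \<omega>, ?Y \<omega>))) h"
    using integrable_inner_direction[OF t] h by (subst integrable_distr_eq) (simp_all add: h_def)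
  then have int: "integrable (distr M ?B ?S \<Otimes>\<^sub>M ?W) h" by (simp only: joint)
  define \<Phi> where "\<Phi> s = (\<Sum>j\<in>UNIV. (gradient F (fst s) $ j)\<^sup>2
      / G (fst s) (snd s) (gradient F (snd s)) $ j)" for s
  have \<Phi>: "(\<lambda>s. \<integral>y. h (s, y) \<partial>?W) = \<Phi>"
    using integral_inner_direction by (auto simp: fun_eq_iff h_def \<Phi>_def)
  \<comment> \<open>Fubini also supplies integrability of the quotient sum.\<close>
  have int_\<Phi>: "integrable (distr M ?B ?S) \<Phi>"
    using integrable_fst'[OF int] by (simp only: \<Phi>)
  have "(\<integral>\<omega>. h (?S \<omega>, ?Y \<omega>) \<partial>M) = integral\<^sup>L (distr M (?B \<Otimes>\<^sub>M ?N) (\<lambda>\<omega>. (?S \<omega>, ?Y \<omega>))) h"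
    using h by (subst integral_distr) simp_all
  also have "\<dots> = integral\<^sup>L (distr M ?B ?S) \<Phi>"
    using integral_fst'[OF int] by (simp only: \<Phi> joint)
  also have "\<dots> = (\<integral>\<omega>. \<Phi> (?S \<omega>) \<partial>M)"
    using borel_measurable_integrable[OF int_\<Phi>] by (subst integral_distr) simp_all
  finally show "(\<integral>\<omega>. gradient F (X t \<omega>) \<bullet> direction (X t \<omega>, Z t \<omega>) (sample \<omega> (Suc t)) \<partial>M)
      = (\<integral>\<omega>. (\<Sum>j\<in>UNIV. (gradient F (X t \<omega>) $ j)\<^sup>2
          / G (X t \<omega>) (Z t \<omega>) (gradient F (Z t \<omega>)) $ j) \<partial>M)"
    by (simp add: h_def \<Phi>_def)
  show "integrable M (\<lambda>\<omega>. \<Sum>j\<in>UNIV. (gradient F (X t \<omega>) $ j)\<^sup>2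
          / G (X t \<omega>) (Z t \<omega>) (gradient F (Z t \<omega>)) $ j)"
    using int_\<Phi> borel_measurable_integrable[OF int_\<Phi>]
    by (subst (asm) integrable_distr_eq) (simp_all add: \<Phi>_def)
qed

section \<open>Descent in one step and summation over the steps\<close>

lemma one_step:
  "F (X (Suc t) \<omega>) \<le> F (X t \<omega>)
    - \<gamma> * (gradient F (X t \<omega>) \<bullet> direction (X t \<omega>, Z t \<omega>) (sample \<omega> (Suc t)))
    + L * \<gamma>\<^sup>2 * real CARD('d) powr enn2real (2 / q) / 2"
proof -
  define s where "s = direction (X t \<omega>, Z t \<omega>) (sample \<omega> (Suc t))"
  have "F (X (Suc t) \<omega>) \<le> F (X t \<omega>) + (- \<gamma> *\<^sub>R s) \<bullet> gradient F (X t \<omega>)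
      + L / 2 * (lp_norm q (- \<gamma> *\<^sub>R s))\<^sup>2"
    using descent[of "X t \<omega>" "- \<gamma> *\<^sub>R s"] by (simp add: X_Suc s_def)
  also have "(lp_norm q (- \<gamma> *\<^sub>R s))\<^sup>2 = \<gamma>\<^sup>2 * (lp_norm q s)\<^sup>2"
    by (simp only: lp_norm_scaleR[OF q_ge_1] power_mult_distrib) simp
  \<comment> \<open>The coordinates of \<open>s\<close> are signs, so its squared q-norm is at most
    d^(2/q).\<close>
  also have "L / 2 * (\<gamma>\<^sup>2 * (lp_norm q s)\<^sup>2)
      \<le> L / 2 * (\<gamma>\<^sup>2 * real CARD('d) powr enn2real (2 / q))"
    using L_pos lp_norm_le_card_powr[OF q_ge_1 abs_direction_le_1]
    by (intro mult_left_mono) (auto simp: s_def)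
  finally show ?thesis
    by (simp add: s_def inner_commute[of "gradient F (X t \<omega>)"] algebra_simps)
qed

text \<open>\<open>R\<close> stands for the stationarity measure of a variant, bounded by the mean
  decrease per unit of \<gamma> at every point within \<open>D\<close> of its reference.\<close>

lemma convergence:
  assumes measurable_R: "R \<in> borel_measurable borel" and R_nonneg: "\<And>x. 0 \<le> R x"
    and R_le: "\<And>x z. lp_norm q (x - z) \<le> D \<Longrightarrow>
      R x \<le> (\<Sum>j\<in>UNIV. (gradient F x $ j)\<^sup>2 / G x z (gradient F z) $ j)"
  defines "x \<equiv> signsvrg_iterate G q D \<gamma> n f x\<^sub>1 i U"
  shows "1 / real T * (\<integral>\<omega>. (\<Sum>t = 1..T. R (x t \<omega>)) \<partial>M)
    \<le> (\<integral>\<omega>. F (x 1 \<omega>) - F (x (T + 1) \<omega>) \<partial>M) / (real T * \<gamma>)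
      + L * \<gamma> * real CARD('d) powr enn2real (2 / q) / 2"
proof -
  \<comment> \<open>The error of \<open>one_step\<close> is \<open>\<gamma> * C\<close>; dividing
    the telescoped sum by \<gamma> leaves \<open>C\<close>.\<close>
  define C where "C = L * \<gamma> * real CARD('d) powr enn2real (2 / q) / 2"
  let ?g = "\<lambda>t \<omega>. gradient F (X t \<omega>) \<bullet> direction (X t \<omega>, Z t \<omega>) (sample \<omega> (Suc t))"
  let ?r = "\<lambda>t \<omega>. \<Sum>j\<in>UNIV. (gradient F (X t \<omega>) $ j)\<^sup>2 / G (X t \<omega>) (Z t \<omega>) (gradient F (Z t \<omega>)) $ j"
  have F_int: "integrable M (\<lambda>\<omega>. F (X t \<omega>))" if "t \<le> T" for t
    by (rule integrable_continuous_X[OF that continuous_on_F])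
  have R_le': "R (X t \<omega>) \<le> ?r t \<omega>" for t \<omega>
    by (rule R_le[OF distance_to_reference])
  \<comment> \<open>\<open>R\<close> lies between 0 and an integrable function.\<close>
  have R_int: "integrable M (\<lambda>\<omega>. R (X t \<omega>))" if "t < T" for t
  proof (rule Bochner_Integration.integrable_bound[OF expectation_inner_direction(2)[OF that]])
    show "(\<lambda>\<omega>. R (X t \<omega>)) \<in> borel_measurable M"
      using measurable_compose[OF measurable_X measurable_R] that by simp
    show "AE \<omega> in M. norm (R (X t \<omega>)) \<le> norm (?r t \<omega>)"
      using R_le'[of t] R_nonneg by (intro AE_I2) (smt (verit) real_norm_def)
  qed
  have step: "\<gamma> * (\<integral>\<omega>. R (X t \<omega>) \<partial>M)
      \<le> (\<integral>\<omega>. F (X t \<omega>) \<partial>M) - (\<integral>\<omega>. F (X (Suc t) \<omega>) \<partial>M) + \<gamma> * C" if t: "t < T" for t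
  proof -
    have "(\<integral>\<omega>. F (X (Suc t) \<omega>) \<partial>M) \<le> (\<integral>\<omega>. F (X t \<omega>) - \<gamma> * ?g t \<omega> + \<gamma> * C \<partial>M)"
      using F_int[of t] F_int[of "Suc t"] integrable_inner_direction[OF t] t one_step
      by (intro integral_mono) (auto simp: C_def power2_eq_square mult_ac)
    also have "\<dots> = (\<integral>\<omega>. F (X t \<omega>) \<partial>M) - \<gamma> * (\<integral>\<omega>. ?g t \<omega> \<partial>M) + \<gamma> * C"
      using F_int[of t] integrable_inner_direction[OF t] t by (simp add: prob_space)
    also have "(\<integral>\<omega>. ?g t \<omega> \<partial>M) = (\<integral>\<omega>. ?r t \<omega> \<partial>M)"
      by (rule expectation_inner_direction(1)[OF t])
    finally have "\<gamma> * (\<integral>\<omega>. ?r t \<omega> \<partial>M)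
        \<le> (\<integral>\<omega>. F (X t \<omega>) \<partial>M) - (\<integral>\<omega>. F (X (Suc t) \<omega>) \<partial>M) + \<gamma> * C" by simp
    moreover have "(\<integral>\<omega>. R (X t \<omega>) \<partial>M) \<le> (\<integral>\<omega>. ?r t \<omega> \<partial>M)"
      by (intro integral_mono R_int[OF t] expectation_inner_direction(2)[OF t] R_le')
    ultimately show ?thesis
      using \<gamma>_pos mult_left_mono[of "\<integral>\<omega>. R (X t \<omega>) \<partial>M" "\<integral>\<omega>. ?r t \<omega> \<partial>M" \<gamma>] by linarith
  qed
  have "\<gamma> * (\<Sum>t<T. \<integral>\<omega>. R (X t \<omega>) \<partial>M)
      \<le> (\<Sum>t<T. (\<integral>\<omega>. F (X t \<omega>) \<partial>M) - (\<integral>\<omega>. F (X (Suc t) \<omega>) \<partial>M) + \<gamma> * C)"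
    unfolding sum_distrib_left by (intro sum_mono step) simp
  also have "\<dots> = (\<integral>\<omega>. F (X 0 \<omega>) - F (X T \<omega>) \<partial>M) + real T * \<gamma> * C"
    using F_int[of 0] F_int[of T] sum_lessThan_telescope'[of "\<lambda>t. \<integral>\<omega>. F (X t \<omega>) \<partial>M" T]
    by (simp add: sum.distrib)
  finally have "(\<Sum>t<T. \<integral>\<omega>. R (X t \<omega>) \<partial>M) / real T
      \<le> (\<integral>\<omega>. F (X 0 \<omega>) - F (X T \<omega>) \<partial>M) / (real T * \<gamma>) + C"
    using \<gamma>_pos T_ge_1 by (simp add: field_simps)
  moreover have "(\<integral>\<omega>. (\<Sum>t = 1..T. R (x t \<omega>)) \<partial>M) = (\<Sum>t<T. \<integral>\<omega>. R (X t \<omega>) \<partial>M)"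
  proof -
    \<comment> \<open>Shift from iterates 1 to T to completed steps 0 to T - 1.\<close>
    have "(\<Sum>t = 1..T. R (x t \<omega>)) = (\<Sum>t<T. R (X t \<omega>))" for \<omega>
      by (rule sum.reindex_bij_witness[of _ Suc "\<lambda>t. t - 1"])
         (auto simp: x_def signsvrg_iterate_eq)
    then show ?thesis using R_int by (simp add: Bochner_Integration.integral_sum)
  qed
  ultimately show ?thesis
    by (simp add: x_def signsvrg_iterate_eq C_def)
qed

end

subsection \<open>The two variants\<close>

text \<open>Cauchy-Schwarz for the splitting of \<bar>a j\<bar> into \<bar>a j\<bar> / sqrt (c j)
  and sqrt (c j).\<close>

lemma square_sum_abs_div_le:
  fixes a c :: "'b \<Rightarrow> real"
  assumes dominated: "\<And>j. j \<in> J \<Longrightarrow> \<bar>a j\<bar> \<le> c j" and "(\<Sum>j\<in>J. c j) \<le> K" "K > 0"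
  shows "(\<Sum>j\<in>J. \<bar>a j\<bar>)\<^sup>2 / K \<le> (\<Sum>j\<in>J. (a j)\<^sup>2 / c j)"
proof -
  have c: "0 \<le> c j" if "j \<in> J" for j
    using dominated[OF that] by linarith
  \<comment> \<open>Where \<open>c j = 0\<close>, domination gives \<open>a j = 0\<close>, so the
    splitting also holds there.\<close>
  have "(\<Sum>j\<in>J. \<bar>a j\<bar>) = (\<Sum>j\<in>J. (\<bar>a j\<bar> / sqrt (c j)) * sqrt (c j))"
    using dominated by (intro sum.cong) fastforce+
  also have "\<dots>\<^sup>2 \<le> (\<Sum>j\<in>J. (\<bar>a j\<bar> / sqrt (c j))\<^sup>2) * (\<Sum>j\<in>J. (sqrt (c j))\<^sup>2)"
    by (rule Cauchy_Schwarz_ineq_sum)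
  also have "\<dots> = (\<Sum>j\<in>J. (a j)\<^sup>2 / c j) * (\<Sum>j\<in>J. c j)"
    using c by (simp add: power_divide)
  also have "\<dots> \<le> (\<Sum>j\<in>J. (a j)\<^sup>2 / c j) * K"
    using assms(2) c by (intro mult_left_mono sum_nonneg) auto
  finally show ?thesis
    using assms(3) by (simp add: divide_le_eq)
qed

context lipschitz_gradients
begin

text \<open>A coordinate is at most the p-norm, which the Lipschitz bound controls. The right-hand
  side is the scale of the second variant; the first enlarges it further.\<close>

lemma abs_estimator_le:
  assumes "m \<in> {1..n}"
  shows "\<bar>(gradient (f m) x - gradient (f m) z + gradient F z) $ j\<bar>
    \<le> L * lp_norm q (x - z) + \<bar>gradient F z $ j\<bar>"
  using component_le_lp_norm[OF p_ge_1, of "gradient (f m) x - gradient (f m) z" j]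
    lipschitz[OF assms, of x z] by simp

lemma signsvrg_variant1:
  assumes "signsvrg_sampling M n T i U" "D > 0" "\<gamma> > 0" "T \<ge> 1"
  shows "signsvrg f n p q L M T i U (scale_variant1 p q L) D \<gamma>"
proof -
  interpret signsvrg_sampling M n T i U by fact
  show ?thesis
  proof unfold_locales
    show "(\<lambda>(x, z). scale_variant1 p q L x z (gradient F z)) \<in> borel_measurable (borel \<Otimes>\<^sub>M borel)"
      unfolding scale_variant1_def by measurable
    fix m x z j assume "m \<in> {1..n}"
    from abs_estimator_le[OF this, of x z j] component_le_lp_norm[OF p_ge_1, of "gradient F z" j]
    show "\<bar>(gradient (f m) x - gradient (f m) z + gradient F z) $ j\<bar>
        \<le> scale_variant1 p q L x z (gradient F z) $ j"
      by (simp add: scale_variant1_def)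
  qed fact+
qed

lemma signsvrg_variant2:
  assumes "signsvrg_sampling M n T i U" "D > 0" "\<gamma> > 0" "T \<ge> 1"
  shows "signsvrg f n p q L M T i U (scale_variant2 q L) D \<gamma>"
proof -
  interpret signsvrg_sampling M n T i U by fact
  show ?thesis
  proof unfold_locales
    show "(\<lambda>(x, z). scale_variant2 q L x z (gradient F z)) \<in> borel_measurable (borel \<Otimes>\<^sub>M borel)"
      unfolding scale_variant2_def by measurable
    show "\<bar>(gradient (f m) x - gradient (f m) z + gradient F z) $ j\<bar>
        \<le> scale_variant2 q L x z (gradient F z) $ j" if "m \<in> {1..n}" for m x z j
      using abs_estimator_le[OF that, of x z j] by (simp add: scale_variant2_def)
  qed fact+
qed

lemma lp_norm_gradient_reference_le:
  assumes "lp_norm q (x - z) \<le> D"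
  shows "lp_norm p (gradient F z - gradient F x) \<le> L * D"
proof -
  have "lp_norm p (gradient F z - gradient F x) \<le> L * lp_norm q (x - z)"
    using lipschitz_F[of x z] by (simp only: lp_norm_minus_commute[of p "gradient F z"])
  also have "\<dots> \<le> L * D"
    using assms L_pos by simp
  finally show ?thesis .
qed

text \<open>All coordinates share the scale \<open>c\<close>. One \<open>L * D\<close> comes from
  the distance to the reference, the other from replacing the gradient at \<open>z\<close> by that
  at \<open>x\<close>.\<close>

lemma variant1_bound:
  assumes "signsvrg f n p q L M T i U (scale_variant1 p q L) D \<gamma>" and near: "lp_norm q (x - z) \<le> D"
  shows "(norm (gradient F x))\<^sup>2 / (2 * L * D + lp_norm p (gradient F x))
    \<le> (\<Sum>j\<in>UNIV. (gradient F x $ j)\<^sup>2 / scale_variant1 p q L x z (gradient F z) $ j)"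
proof -
  interpret signsvrg f n p q L M T i U "scale_variant1 p q L" D \<gamma> by fact
  define K where "K = 2 * L * D + lp_norm p (gradient F x)"
  define c where "c = L * lp_norm q (x - z) + lp_norm p (gradient F z)"
  have "lp_norm p (gradient F z) \<le> L * D + lp_norm p (gradient F x)"
    using lp_norm_triangle[OF p_ge_1, of "gradient F z - gradient F x" "gradient F x"]
      lp_norm_gradient_reference_le[OF near] by simp
  moreover have "L * lp_norm q (x - z) \<le> L * D"
    using near L_pos by simp
  ultimately have "c \<le> K" by (simp add: c_def K_def)
  have "K > 0"
    using L_pos D_pos by (simp add: K_def add_pos_nonneg)
  have "(norm (gradient F x))\<^sup>2 / K = (\<Sum>j\<in>UNIV. (gradient F x $ j)\<^sup>2 / K)"
    unfolding power2_norm_eq_inner by (simp add: inner_vec_def power2_eq_square sum_divide_distrib)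
  also have "\<dots> \<le> (\<Sum>j\<in>UNIV. (gradient F x $ j)\<^sup>2 / c)"
  proof (rule sum_mono)
    fix j
    \<comment> \<open>This settles the case \<open>c = 0\<close>: the coordinate vanishes and both
      quotients are 0.\<close>
    have "\<bar>gradient F x $ j\<bar> \<le> c"
      using abs_gradient_F_le_scale[of x j z] by (simp add: scale_variant1_def c_def)
    then show "(gradient F x $ j)\<^sup>2 / K \<le> (gradient F x $ j)\<^sup>2 / c"
      using \<open>c \<le> K\<close> \<open>K > 0\<close> by (cases "c = 0") (auto intro!: divide_left_mono)
  qed
  finally show ?thesis by (simp add: K_def c_def scale_variant1_def)
qed

text \<open>The scales differ between coordinates, so Cauchy-Schwarz is used with a bound on their
  sum. Each contributes at most \<open>2 * L * D\<close> beyond the gradient coordinate, whence the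
  factor d.\<close>

lemma variant2_bound:
  assumes "signsvrg f n p q L M T i U (scale_variant2 q L) D \<gamma>" and near: "lp_norm q (x - z) \<le> D"
  shows "(lp_norm 1 (gradient F x))\<^sup>2 / (2 * L * real CARD('d) * D + lp_norm 1 (gradient F x))
    \<le> (\<Sum>j\<in>UNIV. (gradient F x $ j)\<^sup>2 / scale_variant2 q L x z (gradient F z) $ j)"
  unfolding lp_norm_one
proof (rule square_sum_abs_div_le)
  interpret signsvrg f n p q L M T i U "scale_variant2 q L" D \<gamma> by fact
  show "\<bar>gradient F x $ j\<bar> \<le> scale_variant2 q L x z (gradient F z) $ j" for j
    by (rule abs_gradient_F_le_scale)
  have "(\<Sum>j\<in>UNIV. scale_variant2 q L x z (gradient F z) $ j)
      \<le> (\<Sum>j\<in>(UNIV :: 'd set). 2 * L * D + \<bar>gradient F x $ j\<bar>)"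
  proof (rule sum_mono)
    fix j
    have "\<bar>gradient F z $ j\<bar> \<le> L * D + \<bar>gradient F x $ j\<bar>"
      using component_le_lp_norm[OF p_ge_1, of "gradient F z - gradient F x" j]
        lp_norm_gradient_reference_le[OF near] by simp
    moreover have "L * lp_norm q (x - z) \<le> L * D"
      using near L_pos by simp
    ultimately show "scale_variant2 q L x z (gradient F z) $ j \<le> 2 * L * D + \<bar>gradient F x $ j\<bar>"
      by (simp add: scale_variant2_def)
  qed
  then show "(\<Sum>j\<in>UNIV. scale_variant2 q L x z (gradient F z) $ j)
      \<le> 2 * L * real CARD('d) * D + (\<Sum>j\<in>UNIV. \<bar>gradient F x $ j\<bar>)"
    by (simp add: sum.distrib mult_ac)
  show "2 * L * real CARD('d) * D + (\<Sum>j\<in>UNIV. \<bar>gradient F x $ j\<bar>) > 0"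
    using L_pos D_pos by (simp add: add_pos_nonneg sum_nonneg)
qed

end

theorem theorem2:
  fixes f :: "nat \<Rightarrow> real ^ 'd \<Rightarrow> real" and n T :: nat and p q :: ennreal
    and L\<^sub>q D \<gamma> :: real and x\<^sub>1 :: "real ^ 'd"
    and M :: "'a measure" and i :: "nat \<Rightarrow> 'a \<Rightarrow> nat" and U :: "nat \<Rightarrow> 'a \<Rightarrow> real ^ 'd"
  assumes "n \<ge> 1" and "T \<ge> 1"
    and "p \<ge> 1" and "q \<ge> 1" and "1 / p + 1 / q = 1"
    and "\<And>m x. m \<in> {1..n} \<Longrightarrow> f m differentiable at x"
    and "\<And>m. m \<in> {1..n} \<Longrightarrow> continuous_on UNIV (gradient (f m))"
    and "L\<^sub>q > 0"
    and "\<And>m x y. m \<in> {1..n} \<Longrightarrow>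
      lp_norm p (gradient (f m) x - gradient (f m) y) \<le> L\<^sub>q * lp_norm q (x - y)"
    and "D > 0" and "\<gamma> > 0"
    and "signsvrg_sampling M n T i U"
  shows
    "(let F = average n f;
          x = signsvrg_iterate (scale_variant1 p q L\<^sub>q) q D \<gamma> n f x\<^sub>1 i U
      in 1 / real T * (\<integral>\<omega>. (\<Sum>t = 1..T. (norm (gradient F (x t \<omega>)))\<^sup>2 /
             (2 * L\<^sub>q * D + lp_norm p (gradient F (x t \<omega>)))) \<partial>M)
         \<le> (\<integral>\<omega>. F (x 1 \<omega>) - F (x (T + 1) \<omega>) \<partial>M) / (real T * \<gamma>)
           + L\<^sub>q * \<gamma> * real CARD('d) powr enn2real (2 / q) / 2)
     \<and>
     (let F = average n f;
          x = signsvrg_iterate (scale_variant2 q L\<^sub>q) q D \<gamma> n f x\<^sub>1 i U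
      in 1 / real T * (\<integral>\<omega>. (\<Sum>t = 1..T. (lp_norm 1 (gradient F (x t \<omega>)))\<^sup>2 /
             (2 * L\<^sub>q * real CARD('d) * D + lp_norm 1 (gradient F (x t \<omega>)))) \<partial>M)
         \<le> (\<integral>\<omega>. F (x 1 \<omega>) - F (x (T + 1) \<omega>) \<partial>M) / (real T * \<gamma>)
           + L\<^sub>q * \<gamma> * real CARD('d) powr enn2real (2 / q) / 2)"
proof -
  interpret lipschitz_gradients f n p q L\<^sub>q
    using assms by unfold_locales auto
  note variant1 = signsvrg_variant1[OF assms(12,10,11,2)]
  note variant2 = signsvrg_variant2[OF assms(12,10,11,2)]
  interpret V1: signsvrg f n p q L\<^sub>q M T i U "scale_variant1 p q L\<^sub>q" D \<gamma> x\<^sub>1 by (rule variant1)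
  interpret V2: signsvrg f n p q L\<^sub>q M T i U "scale_variant2 q L\<^sub>q" D \<gamma> x\<^sub>1 by (rule variant2)
  \<comment> \<open>The left-hand sides of the two variant bounds are the choices of
    \<open>R\<close> in \<open>convergence\<close>; measurability and nonnegativity remain to be
    checked.\<close>
  have "(\<lambda>x. (norm (gradient F x))\<^sup>2 / (2 * L\<^sub>q * D + lp_norm p (gradient F x)))
      \<in> borel_measurable borel"
    by measurable
  moreover have "(\<lambda>x. (lp_norm 1 (gradient F x))\<^sup>2
        / (2 * L\<^sub>q * real CARD('d) * D + lp_norm 1 (gradient F x))) \<in> borel_measurable borel"
    by measurable
  moreover have "0 \<le> a\<^sup>2 / (2 * L\<^sub>q * D + lp_norm p u)"
      "0 \<le> a\<^sup>2 / (2 * L\<^sub>q * real CARD('d) * D + lp_norm 1 u)" for a and u :: "real ^ 'd"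
    using L_pos \<open>D > 0\<close> by simp_all
  ultimately show ?thesis
    using V1.convergence[OF _ _ variant1_bound[OF variant1]]
      V2.convergence[OF _ _ variant2_bound[OF variant2]]
    unfolding Let_def by blast
qed

end
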